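(* Let $s\in(1,2]$ and $m,n\in\mathbb{N}$. Then the set $H_s[0,1]\cap B_s[0,1]$ of all $f\in C[0,1]$ with $\dim_H G_f([0,1])=s$ and $\dim_B G_f([0,1])=s$ is $(n,n+m)$-lineable.
   Context: $C[0,1]$ is the real vector space of real-valued continuous functions on $[0,1]$. $G_f(X)=\{(x,f(x)):x\in X\}$. $\dim_H$ is Hausdorff dimension; $\dim_B A$ is the box dimension, i.e. $B_s[0,1]$ consists of those $f$ for which the lower and upper box dimensions of $G_f([0,1])$ coincide and equal $s$. For cardinals $\alpha<\beta$, a subset $A$ of a vector space is $\alpha$-lineable if there is an $\alpha$-dimensional linear subspace $M\subseteq A\cup\{0\}$, and $(\alpha,\beta)$-lineable if it is $\alpha$-lineable and every $\alpha$-dimensional subspace $W_\alpha\subseteq A\cup\{0\}$ is contained in some $\beta$-dimensional subspace $W_\beta\subseteq A\cup\{0\}$. *)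

theory Defs
  imports "HOL-Analysis.Analysis" "HOL-Library.Function_Algebras"
begin

instantiation "fun" :: (type, real_vector) real_vector
begin
definition scaleR_fun :: "real \<Rightarrow> ('a \<Rightarrow> 'b) \<Rightarrow> 'a \<Rightarrow> 'b"
  where "scaleR_fun c f = (\<lambda>x. c *\<^sub>R f x)"
instance
  by standard (auto simp: scaleR_fun_def fun_eq_iff scaleR_add_right scaleR_add_left
      algebra_simps)
end

text \<open>C[0,1] is represented by the functions real \<Rightarrow> real that are continuous on [0,1]
  and vanish outside [0,1] (a canonical representative of each element of C[0,1]).
  This set is a linear subspace of real \<Rightarrow> real, linearly isomorphic to C[0,1].\<close>

definition C01 :: "(real \<Rightarrow> real) set" where
  "C01 = {f. continuous_on {0..1} f \<and> (\<forall>x. x \<notin> {0..1} \<longrightarrow> f x = 0)}"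

definition graph_on :: "(real \<Rightarrow> real) \<Rightarrow> real set \<Rightarrow> (real \<times> real) set" where
  "graph_on f X = {(x, f x) | x. x \<in> X}"

definition hausdorff_pre :: "real \<Rightarrow> real \<Rightarrow> 'a::metric_space set \<Rightarrow> ennreal" where
  "hausdorff_pre s \<delta> E =
     (INF U \<in> {U :: nat \<Rightarrow> 'a set. E \<subseteq> (\<Union>i. U i) \<and>
                 (\<forall>i. bounded (U i) \<and> diameter (U i) \<le> \<delta>)}.
        (\<Sum>i. ennreal (diameter (U i) powr s)))"

definition hausdorff_measure :: "real \<Rightarrow> 'a::metric_space set \<Rightarrow> ennreal" where
  "hausdorff_measure s E = (SUP \<delta> \<in> {0<..}. hausdorff_pre s \<delta> E)"

definition hausdorff_dim :: "'a::metric_space set \<Rightarrow> real" where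
  "hausdorff_dim E = Inf {s. s > 0 \<and> hausdorff_measure s E = 0}"

definition box_count :: "real \<Rightarrow> 'a::metric_space set \<Rightarrow> nat" where
  "box_count \<delta> F = (LEAST n. \<exists>U :: nat \<Rightarrow> 'a set. F \<subseteq> (\<Union>i<n. U i) \<and>
                        (\<forall>i<n. bounded (U i) \<and> diameter (U i) \<le> \<delta>))"

definition lower_box_dim :: "'a::metric_space set \<Rightarrow> ereal" where
  "lower_box_dim F = Liminf (at_right 0) (\<lambda>\<delta>. ereal (ln (real (box_count \<delta> F)) / - ln \<delta>))"

definition upper_box_dim :: "'a::metric_space set \<Rightarrow> ereal" where
  "upper_box_dim F = Limsup (at_right 0) (\<lambda>\<delta>. ereal (ln (real (box_count \<delta> F)) / - ln \<delta>))"

definition HB :: "real \<Rightarrow> (real \<Rightarrow> real) set" where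
  "HB s = {f \<in> C01. hausdorff_dim (graph_on f {0..1}) = s \<and>
                   lower_box_dim (graph_on f {0..1}) = ereal s \<and>
                   upper_box_dim (graph_on f {0..1}) = ereal s}"

definition lineable :: "'v::real_vector set \<Rightarrow> nat \<Rightarrow> bool" where
  "lineable A \<alpha> = (\<exists>M. subspace M \<and> dim M = \<alpha> \<and> M \<subseteq> A \<union> {0})"

definition lineable_pair :: "'v::real_vector set \<Rightarrow> nat \<Rightarrow> nat \<Rightarrow> bool" where
  "lineable_pair A \<alpha> \<beta> = (lineable A \<alpha> \<and>
     (\<forall>W. subspace W \<and> dim W = \<alpha> \<and> W \<subseteq> A \<union> {0} \<longrightarrow>
        (\<exists>W'. subspace W' \<and> dim W' = \<beta> \<and> W \<subseteq> W' \<and> W' \<subseteq> A \<union> {0})))"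

end

theory Submission
  imports Defs
begin

text \<open>
  It suffices to show that for every finite set \<open>B\<close> of continuous functions there is a single
  \<open>g\<close> such that \<open>f + c g\<close> lies in \<open>HB s\<close> for all \<open>c \<noteq> 0\<close> and all \<open>f \<in> span B\<close> whose graph has
  upper box dimension at most \<open>s\<close>; then subspaces can be enlarged one dimension at a time.

  Let \<open>C\<close> be the Cantor function of the self-similar Cantor set \<open>K\<close> of dimension \<open>s - 1\<close>
  (the identity for \<open>s = 2\<close>) and put \<open>g = h \<circ> C\<close> with
  \<open>h u = (\<Sum>k. 2\<^sup>-\<^sup>k tri (2 ^ p k * u))\<close> for an extremely fast growing sequence \<open>p\<close>.
  Since \<open>g\<close> is constant on the gaps of \<open>K\<close>, the graph of \<open>f + c g\<close> is there a vertical translate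
  of that of \<open>f\<close>, while above the few intervals covering \<open>K\<close> a trivial cover is good enough: the
  upper box dimension stays at most \<open>s\<close>, whatever \<open>h\<close> is.
  For the lower bound, weigh a set \<open>U\<close> of diameter \<open>r\<close> with the Lebesgue measure of \<open>C\<close> of its
  horizontal projection, which lies in an interval of length about \<open>r powr (s - 1)\<close>. Choose \<open>k\<close> with
  \<open>rho k \<le> r < rho (k - 1)\<close>. As \<open>p k\<close> is so large that \<open>f\<close> and the first \<open>k\<close> waves vary by less
  than \<open>r\<close> over half a period of the \<open>k\<close>-th wave, equidistribution of the latter gains a
  factor \<open>r\<close>, up to the negligible \<open>2 ^ k\<close>; the mass distribution principle applies.
\<close>

section \<open>Box counting and mass distribution\<close>

text \<open>Finite families instead of the indexed sequences of \<open>box_count\<close>, so that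
  covers can be written as images and unions with a mere upper bound on their number.\<close>

definition coverable :: "real \<Rightarrow> nat \<Rightarrow> 'a::metric_space set \<Rightarrow> bool" where
  "coverable \<delta> n E \<longleftrightarrow> (\<exists>F. finite F \<and> card F \<le> n \<and> E \<subseteq> \<Union>F \<and> (\<forall>A\<in>F. bounded A \<and> diameter A \<le> \<delta>))"

lemma coverable_iff_indexed:
  assumes "0 \<le> \<delta>"
  shows "coverable \<delta> n E \<longleftrightarrow> (\<exists>U :: nat \<Rightarrow> 'a::metric_space set. E \<subseteq> (\<Union>i<n. U i) \<and>
           (\<forall>i<n. bounded (U i) \<and> diameter (U i) \<le> \<delta>))" (is "?L \<longleftrightarrow> ?R")
proof
  assume ?L
  then obtain F where F: "finite F" "card F \<le> n" "E \<subseteq> \<Union>F" "\<And>A. A \<in> F \<Longrightarrow> bounded A \<and> diameter A \<le> \<delta>"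
    unfolding coverable_def by blast
  obtain e where e: "bij_betw e {0..<card F} F"
    using ex_bij_betw_nat_finite[OF F(1)] by blast
  \<comment> \<open>Surplus indices get the empty set, whose diameter is 0; this is where
    \<open>0 \<le> \<delta>\<close> enters.\<close>
  define U where "U i = (if i < card F then e i else {})" for i
  have im: "e i \<in> F" if "i < card F" for i
    using e that unfolding bij_betw_def by auto
  have "\<exists>i<n. x \<in> U i" if "x \<in> E" for x
  proof -
    obtain A where A: "A \<in> F" "x \<in> A" using F(3) \<open>x \<in> E\<close> by blast
    then obtain i where "i < card F" "e i = A"
      using bij_betw_imp_surj_on[OF e] by (metis atLeastLessThan_iff imageE)
    then show ?thesis using A F(2) by (intro exI[of _ i]) (auto simp: U_def)
  qed
  moreover have "\<forall>i<n. bounded (U i) \<and> diameter (U i) \<le> \<delta>"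
    using F(4) im assms by (auto simp: U_def)
  ultimately show ?R by (intro exI[of _ U]) auto
next
  assume ?R
  then obtain U :: "nat \<Rightarrow> 'a set" where U: "E \<subseteq> (\<Union>i<n. U i)"
    "\<forall>i<n. bounded (U i) \<and> diameter (U i) \<le> \<delta>" by blast
  show ?L unfolding coverable_def
    using U card_image_le[of "{..<n}" U] by (intro exI[of _ "U ` {..<n}"]) auto
qed

lemma box_count_eq_Least: "0 \<le> \<delta> \<Longrightarrow> box_count \<delta> E = (LEAST n. coverable \<delta> n E)"
  by (simp add: box_count_def coverable_iff_indexed)

lemma box_count_le: "0 \<le> \<delta> \<Longrightarrow> coverable \<delta> n E \<Longrightarrow> box_count \<delta> E \<le> n"
  by (simp add: box_count_eq_Least Least_le)

lemma coverable_box_count: "0 \<le> \<delta> \<Longrightarrow> coverable \<delta> n E \<Longrightarrow> coverable \<delta> (box_count \<delta> E) E"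
  by (simp add: box_count_eq_Least) (rule LeastI)

lemma bounded_diameter_leI:
  assumes "0 \<le> d" "\<And>x y. x \<in> S \<Longrightarrow> y \<in> S \<Longrightarrow> dist x y \<le> d"
  shows "bounded S \<and> diameter S \<le> d"
proof
  show "bounded S"
  proof (cases "S = {}")
    case False
    then show ?thesis using assms(2) unfolding bounded_def by blast
  qed auto
  show "diameter S \<le> d" using assms by (auto simp: diameter_def intro!: cSUP_least)
qed

lemma compact_imp_coverable:
  assumes "compact E" "0 < \<delta>"
  shows "\<exists>n. coverable \<delta> n E"
proof -
  obtain k where k: "finite k" "k \<subseteq> E" "E \<subseteq> (\<Union>x\<in>k. ball x (\<delta>/2))"
    using compactE_image[OF assms(1), of E "\<lambda>x. ball x (\<delta>/2)"] assms(2)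
    by (metis UN_I centre_in_ball half_gt_zero open_ball subsetI)
  have "bounded (ball x (\<delta>/2)) \<and> diameter (ball x (\<delta>/2)) \<le> \<delta>" for x :: 'a
    using assms(2) by (intro bounded_diameter_leI) (auto intro: less_imp_le[OF dist_triangle_half_r])
  then show ?thesis unfolding coverable_def
    using k by (intro exI[of _ "card ((\<lambda>x. ball x (\<delta>/2)) ` k)"] exI[of _ "(\<lambda>x. ball x (\<delta>/2)) ` k"]) auto
qed

text \<open>Upper box dimension at most \<open>s\<close>, free of logarithms. Letting
  \<open>t > s\<close> vary makes constant factors in the counts harmless.\<close>

definition box_le :: "real \<Rightarrow> 'a::metric_space set \<Rightarrow> bool" where
  "box_le s E \<longleftrightarrow> (\<forall>t>s. \<forall>\<^sub>F \<delta> in at_right 0. \<exists>n. coverable \<delta> n E \<and> real n \<le> \<delta> powr - t)"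

lemma box_le_mono: "box_le s E \<Longrightarrow> s \<le> s' \<Longrightarrow> box_le s' E"
  by (auto simp: box_le_def)

lemma eventually_small:
  fixes e :: real assumes "0 < e" shows "\<forall>\<^sub>F \<delta> in at_right 0. 0 < \<delta> \<and> \<delta> < e"
  using assms by (auto simp: eventually_at_right_field intro!: exI[of _ e])

lemma eventually_le_powr:
  fixes c e :: real assumes "0 < c" "0 < e"
  shows "\<forall>\<^sub>F \<delta> in at_right 0. \<delta> powr e \<le> c"
proof -
  have "\<forall>\<^sub>F \<delta> in at_right 0. 0 < \<delta> \<and> \<delta> < c powr (1/e)"
    by (rule eventually_small) (use assms in auto)
  then show ?thesis
  proof eventually_elim
    case (elim \<delta>)
    then have "\<delta> powr e \<le> (c powr (1/e)) powr e"
      by (intro powr_mono2) (use assms in auto)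
    also have "\<dots> = c" using assms by (simp add: powr_powr)
    finally show ?case .
  qed
qed

lemma upper_box_dim_le:
  assumes "box_le s E" "0 \<le> s"
  shows "upper_box_dim E \<le> ereal s"
proof (rule ereal_le_epsilon2)
  fix e :: real assume e: "0 < e"
  have "\<forall>\<^sub>F \<delta> in at_right 0. \<exists>n. coverable \<delta> n E \<and> real n \<le> \<delta> powr - (s + e)"
    by (rule assms(1)[unfolded box_le_def, rule_format]) (use e in simp)
  moreover have "\<forall>\<^sub>F \<delta> in at_right (0::real). 0 < \<delta> \<and> \<delta> < 1"
    by (rule eventually_small) auto
  ultimately have "\<forall>\<^sub>F \<delta> in at_right 0. ereal (ln (real (box_count \<delta> E)) / - ln \<delta>) \<le> ereal (s + e)"
  proof eventually_elim
    case (elim \<delta>)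
    then obtain n where n: "coverable \<delta> n E" "real n \<le> \<delta> powr - (s + e)" by blast
    have b: "real (box_count \<delta> E) \<le> \<delta> powr - (s + e)"
      using box_count_le[OF _ n(1)] n(2) elim by linarith
    have "ln (real (box_count \<delta> E)) \<le> (s + e) * - ln \<delta>"
    proof (cases "box_count \<delta> E = 0")
      \<comment> \<open>Here \<open>ln 0 = 0\<close>, so only the sign of the right-hand side
        matters.\<close>
      case True
      then show ?thesis using elim e assms(2) by (simp add: mult_le_0_iff)
    next
      case False
      then have "ln (real (box_count \<delta> E)) \<le> ln (\<delta> powr - (s + e))"
        using b elim by (subst ln_le_cancel_iff) auto
      then show ?thesis using elim by (simp add: ln_powr algebra_simps)
    qed
    moreover have "0 < - ln \<delta>" using elim by simp
    ultimately have "ln (real (box_count \<delta> E)) / - ln \<delta> \<le> s + e" by (simp only: pos_divide_le_eq)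
    then show ?case by simp
  qed
  then show "upper_box_dim E \<le> ereal s + ereal e"
    unfolding upper_box_dim_def by (simp add: Limsup_bounded)
qed

lemma box_leI_upper_box_dim:
  assumes "compact E" "upper_box_dim E \<le> ereal s"
  shows "box_le s E"
  unfolding box_le_def
proof (intro allI impI)
  fix t assume "s < t"
  then have "upper_box_dim E < ereal t" using assms(2) by (simp add: order_le_less_trans)
  then have "\<forall>\<^sub>F \<delta> in at_right 0. ereal (ln (real (box_count \<delta> E)) / - ln \<delta>) < ereal t"
    unfolding upper_box_dim_def by (rule Limsup_lessD)
  moreover have "\<forall>\<^sub>F \<delta> in at_right (0::real). 0 < \<delta> \<and> \<delta> < 1"
    by (rule eventually_small) auto
  ultimately show "\<forall>\<^sub>F \<delta> in at_right 0. \<exists>n. coverable \<delta> n E \<and> real n \<le> \<delta> powr - t"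
  proof eventually_elim
    case (elim \<delta>)
    \<comment> \<open>\<open>box_count\<close> is a \<open>LEAST\<close> and describes a cover only
      if some finite cover exists; compactness supplies one.\<close>
    obtain n where "coverable \<delta> n E" using compact_imp_coverable assms(1) elim by blast
    then have c: "coverable \<delta> (box_count \<delta> E) E" using elim by (intro coverable_box_count) auto
    have "real (box_count \<delta> E) \<le> \<delta> powr - t"
    proof (cases "box_count \<delta> E = 0")
      case False
      have "- ln \<delta> > 0" using elim by simp
      then have "ln (real (box_count \<delta> E)) < t * - ln \<delta>" using elim pos_divide_less_eq
        by (metis less_ereal.simps(1))
      also have "\<dots> = ln (\<delta> powr - t)" using elim by (simp add: ln_powr)
      finally show ?thesis using False elim by (subst (asm) ln_less_cancel_iff) auto
    qed auto
    then show ?case using c by blast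
  qed
qed

lemma hausdorff_pre_le_coverable:
  fixes E :: "'a::metric_space set"
  assumes "coverable \<delta> n E" "0 \<le> \<delta>" "\<delta> \<le> \<delta>'" "0 \<le> t"
  shows "hausdorff_pre t \<delta>' E \<le> ennreal (real n * \<delta> powr t)"
proof -
  obtain U :: "nat \<Rightarrow> 'a set" where U: "E \<subseteq> (\<Union>i<n. U i)"
    "\<forall>i<n. bounded (U i) \<and> diameter (U i) \<le> \<delta>"
    using coverable_iff_indexed[OF assms(2), THEN iffD1, OF assms(1)] by (elim exE conjE) (rule that)
  define V where "V i = (if i < n then U i else {})" for i
  have "hausdorff_pre t \<delta>' E \<le> (\<Sum>i. ennreal (diameter (V i) powr t))"
    unfolding hausdorff_pre_def
    by (rule INF_lower) (use U assms in \<open>auto simp: V_def split: if_splits intro: order_trans\<close>)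
  also have "\<dots> = (\<Sum>i<n. ennreal (diameter (V i) powr t))"
    by (rule suminf_finite) (auto simp: V_def)
  also have "\<dots> \<le> (\<Sum>i<n. ennreal (\<delta> powr t))"
    by (rule sum_mono, rule ennreal_leI, rule powr_mono2)
       (use U assms in \<open>auto simp: V_def diameter_ge_0\<close>)
  also have "\<dots> = ennreal (real n * \<delta> powr t)"
    by (simp add: ennreal_mult' ennreal_of_nat_eq_real_of_nat)
  finally show ?thesis .
qed

text \<open>For \<open>s < t' < t\<close>, a cover by at most \<open>\<delta> powr - t'\<close> sets
  of size \<open>\<delta>\<close> has \<open>t\<close>-sum at most
  \<open>\<delta> powr (t - t')\<close>, which tends to 0.\<close>

lemma box_le_imp_hausdorff_null:
  assumes "box_le s E" "0 \<le> s" "s < t"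
  shows "hausdorff_measure t E = 0"
proof -
  define t' where "t' = (s + t) / 2"
  have t': "s < t'" "t' < t" using assms by (auto simp: t'_def)
  have "hausdorff_pre t \<delta>' E \<le> 0" if "0 < \<delta>'" for \<delta>'
  proof (rule ennreal_le_epsilon)
    fix e :: real assume "0 < e"
    have "\<forall>\<^sub>F \<delta> in at_right 0. \<delta> powr (t - t') \<le> e"
      using \<open>0 < e\<close> t' by (intro eventually_le_powr) auto
    moreover have "\<forall>\<^sub>F \<delta> in at_right 0. \<exists>n. coverable \<delta> n E \<and> real n \<le> \<delta> powr - t'"
      using assms(1) t' by (simp add: box_le_def)
    moreover have "\<forall>\<^sub>F \<delta> in at_right 0. 0 < \<delta> \<and> \<delta> < \<delta>'"
      using that by (rule eventually_small)
    ultimately have "\<forall>\<^sub>F \<delta> in at_right (0::real). hausdorff_pre t \<delta>' E \<le> ennreal e"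
    proof eventually_elim
      case (elim \<delta>)
      then obtain n where n: "coverable \<delta> n E" "real n \<le> \<delta> powr - t'" by blast
      have "hausdorff_pre t \<delta>' E \<le> ennreal (real n * \<delta> powr t)"
        using n elim t' assms by (intro hausdorff_pre_le_coverable) auto
      also have "real n * \<delta> powr t \<le> \<delta> powr - t' * \<delta> powr t"
        using n by (intro mult_right_mono) auto
      also have "\<dots> = \<delta> powr (t - t')" by (simp add: powr_add [symmetric])
      also have "\<dots> \<le> e" using elim by simp
      finally show ?case by (simp add: ennreal_leI)
    qed
    then show "hausdorff_pre t \<delta>' E \<le> 0 + ennreal e"
      by (simp add: eventually_const_iff)
  qed
  then have "hausdorff_pre t \<delta>' E = 0" if "0 < \<delta>'" for \<delta>'
    using that by simp
  then show ?thesis unfolding hausdorff_measure_def by (auto intro!: SUP_eq_const simp: SUP_eq_const)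
qed

lemma hausdorff_dim_le:
  assumes "box_le s E" "0 \<le> s"
  shows "hausdorff_dim E \<le> s"
proof (rule dense_ge)
  fix t assume "s < t"
  then show "hausdorff_dim E \<le> t" unfolding hausdorff_dim_def
    using box_le_imp_hausdorff_null[OF assms \<open>s < t\<close>] assms(2)
    by (intro cInf_lower) (auto intro!: bdd_belowI[of _ 0])
qed

text \<open>The outcome of a mass distribution argument. Stated for covers rather than for a
  measure, it feeds both the Hausdorff and the lower box dimension.\<close>

definition mass_ge :: "real \<Rightarrow> 'a::metric_space set \<Rightarrow> bool" where
  "mass_ge t E \<longleftrightarrow> (\<exists>c>0. \<exists>\<delta>>0. \<forall>U :: nat \<Rightarrow> 'a set. E \<subseteq> (\<Union>i. U i) \<longrightarrow>
     (\<forall>i. bounded (U i) \<and> diameter (U i) \<le> \<delta>) \<longrightarrow> ennreal c \<le> (\<Sum>i. ennreal (diameter (U i) powr t)))"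

lemma mass_ge_imp_hausdorff_pos:
  fixes E :: "'a::metric_space set"
  assumes "mass_ge t E" "t' \<le> t"
  shows "hausdorff_measure t' E \<noteq> 0"
proof -
  obtain c \<delta> where c: "0 < c" "0 < \<delta>" and
    cov: "\<And>U :: nat \<Rightarrow> 'a set. E \<subseteq> (\<Union>i. U i) \<Longrightarrow> (\<And>i. bounded (U i) \<and> diameter (U i) \<le> \<delta>) \<Longrightarrow>
       ennreal c \<le> (\<Sum>i. ennreal (diameter (U i) powr t))"
    using assms(1) unfolding mass_ge_def by blast
  \<comment> \<open>For diameters up to 1, lowering the exponent can only enlarge the terms.\<close>
  define \<delta>' where "\<delta>' = min \<delta> 1"
  have "ennreal c \<le> hausdorff_pre t' \<delta>' E"
    unfolding hausdorff_pre_def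
  proof (rule INF_greatest)
    fix U :: "nat \<Rightarrow> 'a set"
    assume "U \<in> {U. E \<subseteq> (\<Union>i. U i) \<and> (\<forall>i. bounded (U i) \<and> diameter (U i) \<le> \<delta>')}"
    then have U: "E \<subseteq> (\<Union>i. U i)" "\<And>i. bounded (U i) \<and> diameter (U i) \<le> \<delta> \<and> diameter (U i) \<le> 1"
      by (auto simp: \<delta>'_def)
    have "ennreal c \<le> (\<Sum>i. ennreal (diameter (U i) powr t))" using U by (intro cov) auto
    also have "\<dots> \<le> (\<Sum>i. ennreal (diameter (U i) powr t'))"
      using U assms(2)
      by (intro suminf_le ennreal_leI powr_mono' summableI) (auto simp: diameter_ge_0)
    finally show "ennreal c \<le> (\<Sum>i. ennreal (diameter (U i) powr t'))" .
  qed
  also have "\<dots> \<le> hausdorff_measure t' E"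
    unfolding hausdorff_measure_def by (rule SUP_upper) (use c in \<open>auto simp: \<delta>'_def\<close>)
  finally show ?thesis using c by auto
qed

lemma hausdorff_dim_ge:
  assumes "\<And>t. 1 < t \<Longrightarrow> t < s \<Longrightarrow> mass_ge t E" "box_le s E" "1 < s"
  shows "s \<le> hausdorff_dim E"
  unfolding hausdorff_dim_def
proof (rule cInf_greatest)
  \<comment> \<open>A real \<open>Inf\<close> is meaningful only for a nonempty set; the upper bound
    supplies the element \<open>s + 1\<close>.\<close>
  show "{t. 0 < t \<and> hausdorff_measure t E = 0} \<noteq> {}"
    using box_le_imp_hausdorff_null[OF assms(2), of "s + 1"] assms(3)
    by (auto intro!: exI[of _ "s + 1"])
  fix t assume t: "t \<in> {t. 0 < t \<and> hausdorff_measure t E = 0}"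
  show "s \<le> t"
  proof (rule ccontr)
    assume "\<not> s \<le> t"
    then obtain t' where "max t 1 < t'" "t' < s" using dense[of "max t 1" s] assms(3) by auto
    then show False using mass_ge_imp_hausdorff_pos[OF assms(1), of t' t] t by auto
  qed
qed

text \<open>Applied to a minimal cover by \<open>n\<close> sets of size \<open>\<delta>\<close>, the
  mass bound gives \<open>c \<le> n * \<delta> powr t'\<close>. Passing from \<open>t'\<close> to
  the smaller \<open>t = s - e\<close> absorbs \<open>c\<close> for small
  \<open>\<delta>\<close>.\<close>

lemma lower_box_dim_ge:
  fixes E :: "'a::metric_space set"
  assumes "\<And>t. 1 < t \<Longrightarrow> t < s \<Longrightarrow> mass_ge t E" "compact E" "1 < s"
  shows "ereal s \<le> lower_box_dim E"
proof (rule ereal_le_epsilon2)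
  fix e :: real assume e: "0 < e"
  obtain t' where t': "max (s - e) 1 < t'" "t' < s" using dense[of "max (s - e) 1" s] assms(3) e by auto
  define t where "t = s - e"
  have tt: "t < t'" using t' by (simp add: t_def)
  obtain c \<delta>' where c: "0 < c" "0 < \<delta>'" and
    cov: "\<And>U :: nat \<Rightarrow> 'a set. E \<subseteq> (\<Union>i. U i) \<Longrightarrow> (\<And>i. bounded (U i) \<and> diameter (U i) \<le> \<delta>') \<Longrightarrow>
       ennreal c \<le> (\<Sum>i. ennreal (diameter (U i) powr t'))"
    using assms(1)[of t'] t' unfolding mass_ge_def by (metis max_less_iff_conj)
  have "\<forall>\<^sub>F \<delta> in at_right 0. \<delta> powr (t' - t) \<le> c"
    using c tt by (intro eventually_le_powr) auto
  moreover have "\<forall>\<^sub>F \<delta> in at_right 0. 0 < \<delta> \<and> \<delta> < min \<delta>' 1"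
    using c by (intro eventually_small) auto
  ultimately have "\<forall>\<^sub>F \<delta> in at_right 0. ereal t \<le> ereal (ln (real (box_count \<delta> E)) / - ln \<delta>)"
  proof eventually_elim
    case (elim \<delta>)
    then have d: "0 < \<delta>" "\<delta> < \<delta>'" "\<delta> < 1" by auto
    define n where "n = box_count \<delta> E"
    obtain n0 where "coverable \<delta> n0 E" using compact_imp_coverable[OF assms(2) d(1)] by blast
    then have "coverable \<delta> n E" unfolding n_def using d by (intro coverable_box_count) auto
    have "ennreal c \<le> hausdorff_pre t' \<delta>' E"
      unfolding hausdorff_pre_def by (rule INF_greatest, rule cov) auto
    also have "\<dots> \<le> ennreal (real n * \<delta> powr t')"
      using \<open>coverable \<delta> n E\<close> d t' by (intro hausdorff_pre_le_coverable) auto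
    finally have cn: "c \<le> real n * \<delta> powr t'" using c by (simp add: ennreal_le_iff)
    have "\<delta> powr (t' - t) \<le> real n * \<delta> powr t'" using elim cn by linarith
    then have "\<delta> powr - t * \<delta> powr t' \<le> real n * \<delta> powr t'" by (simp add: powr_add[symmetric])
    then have "\<delta> powr - t \<le> real n" using d by (simp add: mult_le_cancel_right)
    moreover have "0 < \<delta> powr - t" using d by simp
    ultimately have "ln (\<delta> powr - t) \<le> ln (real n)" by (intro ln_mono) auto
    then have "t * - ln \<delta> \<le> ln (real n)" using d by (simp add: ln_powr)
    moreover have "0 < - ln \<delta>" using d by simp
    ultimately show ?case using pos_le_divide_eq n_def by (metis ereal_less_eq(3))
  qed
  then have "ereal t \<le> lower_box_dim E" unfolding lower_box_dim_def by (rule Liminf_bounded)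
  then show "ereal s \<le> lower_box_dim E + ereal e"
    by (cases "lower_box_dim E") (auto simp: t_def)
qed

section \<open>Membership in \<open>HB s\<close> from the two bounds\<close>

lemma compact_graph_on:
  assumes "f \<in> C01" shows "compact (graph_on f {0..1})"
proof -
  have "graph_on f {0..1} = (\<lambda>x. (x, f x)) ` {0..1}" by (auto simp: graph_on_def)
  then show ?thesis using assms unfolding C01_def
    by (auto intro!: compact_continuous_image continuous_intros)
qed

lemma HB_intro:
  assumes "f \<in> C01" "1 < s" "box_le s (graph_on f {0..1})"
    "\<And>t. 1 < t \<Longrightarrow> t < s \<Longrightarrow> mass_ge t (graph_on f {0..1})"
  shows "f \<in> HB s"
proof -
  let ?E = "graph_on f {0..1}"
  have "hausdorff_dim ?E = s"
    using hausdorff_dim_le[OF assms(3)] hausdorff_dim_ge[OF assms(4,3,2)] assms(2) by force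
  moreover have l: "ereal s \<le> lower_box_dim ?E"
    using lower_box_dim_ge[OF assms(4) compact_graph_on[OF assms(1)] assms(2)] .
  moreover have u: "upper_box_dim ?E \<le> ereal s" using upper_box_dim_le[OF assms(3)] assms(2) by simp
  moreover have "lower_box_dim ?E \<le> upper_box_dim ?E"
    unfolding lower_box_dim_def upper_box_dim_def by (rule Liminf_le_Limsup) simp
  ultimately show ?thesis using assms(1) unfolding HB_def by auto
qed

text \<open>This bound is all that has to be known about the dimension of a function already present
  when a new direction is added to it.\<close>

lemma HB_box_le: "f \<in> HB s \<Longrightarrow> box_le s (graph_on f {0..1})"
  by (rule box_leI_upper_box_dim) (auto simp: HB_def intro: compact_graph_on)

section \<open>The Cantor function of ratio \<open>l\<close>\<close>

text \<open>Distribution functions obtained from the unit mass at 1 by repeatedly averaging its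
  images under the maps \<open>l * x\<close> and \<open>1 - l + l * x\<close>. Starting at 1 makes
  the sequence increasing in \<open>p\<close>.\<close>

primrec cantor_approx :: "real \<Rightarrow> nat \<Rightarrow> real \<Rightarrow> real" where
  "cantor_approx l 0 x = (if x < 1 then 0 else 1)"
| "cantor_approx l (Suc p) x = (cantor_approx l p (x / l) + cantor_approx l p ((x - 1 + l) / l)) / 2"

definition cantor :: "real \<Rightarrow> real \<Rightarrow> real" where
  "cantor l x = lim (\<lambda>p. cantor_approx l p x)"

text \<open>With \<open>l \<le> 1/2\<close> the two copies \<open>{0..l}\<close> and
  \<open>{1 - l..1}\<close> share at most an endpoint. The value \<open>1/2\<close>, for which
  \<open>C\<close> is the identity on the unit interval, belongs to \<open>s = 2\<close>.\<close>

locale cantor_ratio =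
  fixes l :: real
  assumes l0: "0 < l" and l_half: "l \<le> 1/2"
begin

abbreviation "C \<equiv> cantor l"

lemma cantor_approx_bounds: "0 \<le> cantor_approx l p x" "cantor_approx l p x \<le> 1"
proof -
  have "0 \<le> cantor_approx l p x \<and> cantor_approx l p x \<le> 1"
  proof (induction p arbitrary: x)
    case (Suc p) 
    have avg: "0 \<le> (a + b) / 2 \<and> (a + b) / 2 \<le> 1"
      if "0 \<le> a \<and> a \<le> 1" "0 \<le> b \<and> b \<le> 1" for a b :: real
      using that by simp
    show ?case unfolding cantor_approx.simps by (rule avg) (rule Suc.IH)+
  qed auto
  then show "0 \<le> cantor_approx l p x" "cantor_approx l p x \<le> 1" by auto
qed

lemma cantor_approx_nonpos: "x \<le> 0 \<Longrightarrow> cantor_approx l p x = 0"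
proof (induction p arbitrary: x)
  case (Suc p)
  have "x / l \<le> 0" "(x - 1 + l) / l \<le> 0" using Suc.prems l0 l_half by (auto simp: divide_le_0_iff)
  then show ?case using Suc.IH by simp
qed auto

lemma cantor_approx_ge1: "1 \<le> x \<Longrightarrow> cantor_approx l p x = 1"
proof (induction p arbitrary: x)
  case (Suc p)
  have "1 \<le> x / l" "1 \<le> (x - 1 + l) / l" using Suc.prems l0 l_half by (auto simp: le_divide_eq)
  then show ?case using Suc.IH by simp
qed auto

lemma cantor_approx_le_Suc: "cantor_approx l p x \<le> cantor_approx l (Suc p) x"
proof (induction p arbitrary: x)
  case 0
  show ?case
  proof (cases "x < 1")
    case False
    then have "cantor_approx l (Suc 0) x = 1" by (intro cantor_approx_ge1) auto
    then show ?thesis by (simp add: cantor_approx_bounds)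
  qed auto
next
  case (Suc p)
  show ?case
    unfolding cantor_approx.simps(2)[of l "Suc p" x] cantor_approx.simps(2)[of l p x]
    by (intro divide_right_mono add_mono Suc.IH) auto
qed

lemma mono_cantor_approx: "x \<le> y \<Longrightarrow> cantor_approx l p x \<le> cantor_approx l p y"
proof (induction p arbitrary: x y)
  case (Suc p)
  have "cantor_approx l p (x / l) \<le> cantor_approx l p (y / l)"
    using Suc.prems l0 by (intro Suc.IH) (auto simp: divide_right_mono)
  moreover have "cantor_approx l p ((x - 1 + l) / l) \<le> cantor_approx l p ((y - 1 + l) / l)"
    using Suc.prems l0 by (intro Suc.IH) (auto simp: divide_right_mono)
  ultimately show ?case by simp
qed auto

lemma cantor_approx_tendsto: "(\<lambda>p. cantor_approx l p x) \<longlonglongrightarrow> C x"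
proof -
  have "incseq (\<lambda>p. cantor_approx l p x)" by (rule incseq_SucI) (rule cantor_approx_le_Suc)
  then have "convergent (\<lambda>p. cantor_approx l p x)"
    using incseq_convergent[of _ 1] cantor_approx_bounds(2) by (metis convergentI)
  then show ?thesis unfolding cantor_def by (rule convergent_LIMSEQ_iff[THEN iffD1])
qed

lemma cantor_bounds: "0 \<le> C x" "C x \<le> 1"
  by (rule LIMSEQ_le_const[OF cantor_approx_tendsto], simp add: cantor_approx_bounds)
     (rule LIMSEQ_le_const2[OF cantor_approx_tendsto], simp add: cantor_approx_bounds)

lemma cantor_nonpos: "x \<le> 0 \<Longrightarrow> C x = 0"
  using cantor_approx_tendsto[of x] by (simp add: cantor_approx_nonpos LIMSEQ_const_iff)

lemma cantor_ge1: "1 \<le> x \<Longrightarrow> C x = 1"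
  using cantor_approx_tendsto[of x] by (simp add: cantor_approx_ge1 LIMSEQ_const_iff)

lemma cantor_mono: "x \<le> y \<Longrightarrow> C x \<le> C y"
  by (rule LIMSEQ_le[OF cantor_approx_tendsto cantor_approx_tendsto]) (simp add: mono_cantor_approx)

text \<open>The recursion of the approximations passes to the limit. For
  \<open>x \<le> 1 - l\<close> and for \<open>l \<le> x\<close> one summand is constant, which gives
  the two one-sided forms below.\<close>

lemma cantor_split: "C x = (C (x / l) + C ((x - 1 + l) / l)) / 2"
proof -
  have "(\<lambda>p. cantor_approx l (Suc p) x) \<longlonglongrightarrow> (C (x / l) + C ((x - 1 + l) / l)) / 2"
    unfolding cantor_approx.simps by (intro tendsto_intros cantor_approx_tendsto) auto
  then show ?thesis using LIMSEQ_Suc[OF cantor_approx_tendsto[of x]] LIMSEQ_unique by blast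
qed

lemma cantor_left: "x \<le> 1 - l \<Longrightarrow> C x = C (x / l) / 2"
  using cantor_split[of x] l0 by (subst (asm) (3) cantor_nonpos) (auto simp: divide_le_0_iff)

lemma cantor_right: "l \<le> x \<Longrightarrow> C x = (1 + C ((x - 1 + l) / l)) / 2"
  using cantor_split[of x] l0 by (subst (asm) (2) cantor_ge1) (auto simp: le_divide_eq)

lemma cantor_power_le: "v \<le> l ^ p \<Longrightarrow> C v \<le> (1/2) ^ p"
proof (induction p arbitrary: v)
  case 0 then show ?case by (simp add: cantor_bounds)
next
  case (Suc p)
  have "l ^ Suc p \<le> l" using l0 l_half by (simp add: mult_le_cancel_left1 power_le_one)
  then have "C v = C (v / l) / 2" using Suc.prems l_half by (intro cantor_left) linarith
  moreover have "C (v / l) \<le> (1/2)^p"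
    using Suc.prems l0 by (intro Suc.IH) (simp add: divide_le_eq mult.commute)
  ultimately show ?case by simp
qed

lemma cantor_power_ge: "1 - l ^ p \<le> v \<Longrightarrow> 1 - (1/2) ^ p \<le> C v"
proof (induction p arbitrary: v)
  case 0 then show ?case by (simp add: cantor_bounds)
next
  case (Suc p)
  have "l ^ Suc p \<le> l" using l0 l_half by (simp add: mult_le_cancel_left1 power_le_one)
  define w where "w = (v - 1 + l) / l"
  have "C v = (1 + C w) / 2" unfolding w_def
    using Suc.prems l_half \<open>l ^ Suc p \<le> l\<close> by (intro cantor_right) linarith
  moreover have "1 - (1/2)^p \<le> C w"
    unfolding w_def using Suc.prems l0 by (intro Suc.IH) (simp add: le_divide_eq algebra_simps)
  ultimately show ?case by simp
qed

text \<open>Hoelder continuity at the scales \<open>l ^ p\<close>, by self-similarity. The factor 2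
  comes from the third case, where both copies contribute up to \<open>(1/2) ^ p\<close> before
  halving.\<close>

lemma cantor_diff_le:
  "x \<le> y \<Longrightarrow> y - x \<le> l ^ p \<Longrightarrow> C y - C x \<le> 2 * (1/2) ^ p"
proof (induction p arbitrary: x y)
  case 0
  then show ?case using cantor_bounds(1)[of x] cantor_bounds(2)[of y] by simp
next
  case (Suc p)
  have d: "y / l - x / l \<le> l ^ p" "x / l \<le> y / l"
    using Suc.prems l0 by (auto simp: diff_divide_distrib[symmetric] divide_le_eq mult.commute divide_right_mono)
  consider "y \<le> 1 - l" | "l \<le> x" | "x < l" "1 - l < y" by linarith
  then show ?case
  proof cases
    case 1
    then have "C y - C x = (C (y / l) - C (x / l)) / 2"
      using cantor_left[of x] cantor_left[of y] Suc.prems by simp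
    then show ?thesis using Suc.IH[OF d(2,1)] by simp
  next
    case 2
    then have "C y - C x = (C ((y - 1 + l) / l) - C ((x - 1 + l) / l)) / 2"
      using cantor_right[of x] cantor_right[of y] Suc.prems by (simp add: field_simps)
    moreover have "(x - 1 + l) / l \<le> (y - 1 + l) / l" "(y - 1 + l) / l - (x - 1 + l) / l \<le> l ^ p"
      using d by (auto simp: add_divide_distrib diff_divide_distrib)
    ultimately show ?thesis using Suc.IH[of "(x - 1 + l) / l" "(y - 1 + l) / l"] by simp
  next
    case 3
    have a: "C x = C (x / l) / 2" using 3 l_half by (intro cantor_left) linarith
    define w where "w = (y - 1 + l) / l"
    have b: "C y = (1 + C w) / 2" unfolding w_def using 3 l_half by (intro cantor_right) linarith
    have "y - 1 + l \<le> l ^ p * l" using 3 Suc.prems l_half by (simp add: mult.commute)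
    then have "C w \<le> (1/2)^p" unfolding w_def
      using l0 by (intro cantor_power_le) (simp add: divide_le_eq)
    moreover have "l - x \<le> l ^ p * l" using 3 Suc.prems l_half by (simp add: mult.commute)
    then have "1 - (1/2)^p \<le> C (x / l)"
      using l0 by (intro cantor_power_ge) (simp add: le_divide_eq algebra_simps)
    ultimately show ?thesis using a b by simp
  qed
qed

lemma cantor_dist_le: "\<bar>x - y\<bar> \<le> l ^ p \<Longrightarrow> \<bar>C x - C y\<bar> \<le> 2 * (1/2) ^ p"
  using cantor_diff_le[of x y p] cantor_diff_le[of y x p] cantor_mono[of x y] cantor_mono[of y x]
  by (cases "x \<le> y") auto

lemma power_to_0: "0 < e \<Longrightarrow> \<exists>p. l ^ p < e"
  using real_arch_pow_inv[of e l] l_half l0 by auto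

lemma continuous_cantor: "continuous_on UNIV C"
  unfolding continuous_on_iff
proof safe
  fix x e :: real assume "0 < e"
  then obtain p where "(1/2::real) ^ p < e / 2" using real_arch_pow_inv[of "e/2" "1/2"] by auto
  then have "dist (C x') (C x) < e" if "dist x' x < l ^ p" for x'
    using cantor_dist_le[of x' x p] that by (simp add: dist_real_def)
  then show "\<exists>d>0. \<forall>x'\<in>UNIV. dist x' x < d \<longrightarrow> dist (C x') (C x) < e"
    using l0 by (intro exI[of _ "l ^ p"]) auto
qed

lemma cantor_surj: "C ` {0..1} = {0..1}"
proof
  show "C ` {0..1} \<subseteq> {0..1}" using cantor_bounds by auto
  show "{0..1} \<subseteq> C ` {0..1}"
  proof
    fix u :: real assume "u \<in> {0..1}"
    then have "\<exists>x\<ge>0. x \<le> 1 \<and> C x = u"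
      using cantor_nonpos[of 0] cantor_ge1[of 1] continuous_cantor
      by (intro IVT') (auto intro: continuous_on_subset)
    then show "u \<in> C ` {0..1}" by auto
  qed
qed

text \<open>The values in an open dyadic cell are taken on a single construction interval of level
  \<open>p\<close>: the gaps removed up to that level are sent to endpoints of cells, which the
  strict inequalities exclude.\<close>

lemma cantor_inverse_dist:
  fixes j :: int
  assumes "of_int j < 2 ^ p * C x" "2 ^ p * C x < of_int j + 1"
    "of_int j < 2 ^ p * C y" "2 ^ p * C y < of_int j + 1"
  shows "\<bar>x - y\<bar> \<le> l ^ p"
  using assms
proof (induction p arbitrary: x y j)
  case 0
  have inside: "0 < z \<and> z < 1" if "of_int j < C z" "C z < of_int j + 1" for z
  proof -
    have "(of_int j :: real) < of_int 1" "of_int (-1) < (of_int j :: real)"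
      using that cantor_bounds[of z] by auto
    then have "j = 0" unfolding of_int_less_iff by simp
    then have "C z \<noteq> 0" "C z \<noteq> 1" using that by auto
    then show ?thesis using cantor_nonpos[of z] cantor_ge1[of z] by force
  qed
  show ?case using inside[of x] inside[of y] 0 by auto
next
  case (Suc p)
  show ?case
  proof (cases "j + 1 \<le> 2 ^ p")
    case True
    then have "(of_int j + 1 :: real) \<le> 2 ^ p"
      using of_int_le_iff[of "j + 1" "2 ^ p", where 'a = real] by simp
    have lt: "z < l" if "2 ^ Suc p * C z < of_int j + 1" for z
    proof (rule ccontr)
      assume "\<not> z < l"
      then have "1/2 \<le> C z" using cantor_right[of z] cantor_bounds[of "(z - 1 + l)/l"] by simp
      then have "2 ^ p \<le> 2 ^ Suc p * C z" by simp
      then show False using that \<open>of_int j + 1 \<le> 2 ^ p\<close> by linarith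
    qed
    have e: "C x = C (x / l) / 2" "C y = C (y / l) / 2"
      using lt[OF Suc.prems(2)] lt[OF Suc.prems(4)] l_half by (intro cantor_left; linarith)+
    have "\<bar>x / l - y / l\<bar> \<le> l ^ p"
      using Suc.prems unfolding e by (intro Suc.IH[of j]) (simp_all add: mult.commute)
    then show ?thesis using l0
      by (simp add: diff_divide_distrib[symmetric] divide_le_eq mult.commute)
  next
    case False
    then have "2 ^ p \<le> j" by simp
    then have j: "2 ^ p \<le> (of_int j :: real)"
      using of_int_le_iff[of "2 ^ p" j, where 'a = real] by simp
    have gt: "1 - l < z" if "of_int j < 2 ^ Suc p * C z" for z
    proof (rule ccontr)
      assume "\<not> 1 - l < z"
      then have "C z \<le> 1/2" using cantor_left[of z] cantor_bounds[of "z / l"] by simp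
      then have "2 ^ Suc p * C z \<le> 2 ^ p" by simp
      then show False using that j by linarith
    qed
    define v w where "v = (x - 1 + l) / l" "w = (y - 1 + l) / l"
    have e: "C x = (1 + C v) / 2" "C y = (1 + C w) / 2" unfolding v_w_def
      using gt[OF Suc.prems(1)] gt[OF Suc.prems(3)] l_half by (intro cantor_right; linarith)+
    have "\<bar>v - w\<bar> \<le> l ^ p" using Suc.prems unfolding e
      by (intro Suc.IH[of "j - 2 ^ p"]) (simp_all add: algebra_simps)
    then show ?thesis using l0 unfolding v_w_def
      by (simp add: diff_divide_distrib[symmetric] divide_le_eq mult.commute)
  qed
qed

end

section \<open>Rapidly oscillating sums of triangle waves\<close>

definition tri :: "real \<Rightarrow> real" where
  "tri x = \<bar>x - of_int (round x)\<bar>"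

lemma tri_le: "tri x \<le> \<bar>x - of_int m\<bar>"
  unfolding tri_def by (rule round_diff_minimal)

lemma tri_bounds: "0 \<le> tri x" "tri x \<le> 1/2"
  using of_int_round_abs_le[of x] by (auto simp: tri_def abs_minus_commute)

lemma tri_lipschitz: "\<bar>tri x - tri y\<bar> \<le> \<bar>x - y\<bar>"
  using tri_le[of x "round y"] tri_le[of y "round x"] unfolding tri_def by linarith

lemma tri_add_int: "tri (x + of_int m) = tri x"
  using tri_le[of "x + of_int m" "round x + m"] tri_le[of x "round (x + of_int m) - m"]
  unfolding tri_def by simp

text \<open>On a half period the slope is constantly 1 or -1, according to the parity of
  \<open>j\<close>. Hence the value of a wave determines the point within a half period.\<close>

lemma tri_isometry:
  fixes j :: int
  assumes "of_int j / 2 \<le> x" "x \<le> (of_int j + 1) / 2" "of_int j / 2 \<le> y" "y \<le> (of_int j + 1) / 2"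
  shows "\<bar>tri x - tri y\<bar> = \<bar>x - y\<bar>"
proof -
  have far: "i \<le> m \<or> m \<le> i - 1 \<Longrightarrow> of_int i \<le> (of_int m :: real) \<or> of_int m \<le> of_int i - (1 :: real)" for i m :: int
    using of_int_le_iff[of i m, where 'a = real] of_int_le_iff[of m "i - 1", where 'a = real] by auto
  show ?thesis
  proof (cases "even j")
    case True
    then obtain i where i: "j = 2 * i" by blast
    have "tri z = z - of_int i" if "of_int j / 2 \<le> z" "z \<le> (of_int j + 1) / 2" for z
    proof (rule antisym)
      show "tri z \<le> z - of_int i" using tri_le[of z i] that i by simp
      show "z - of_int i \<le> tri z" using that i far[of "i + 1" "round z"] unfolding tri_def by fastforce
    qed
    then show ?thesis using assms by simp
  next
    case False
    then obtain i where i: "j = 2 * i + 1" by (rule oddE)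
    have "tri z = of_int i + 1 - z" if "of_int j / 2 \<le> z" "z \<le> (of_int j + 1) / 2" for z
    proof (rule antisym)
      show "tri z \<le> of_int i + 1 - z" using tri_le[of z "i + 1"] that i by simp
      show "of_int i + 1 - z \<le> tri z" using that i far[of "i + 1" "round z"] unfolding tri_def by fastforce
    qed
    then show ?thesis using assms by simp
  qed
qed

text \<open>The set injects into an interval of length \<open>d\<close> modulo \<open>d\<close>.\<close>

lemma emeasure_le_no_multiple_differences:
  fixes S :: "real set"
  assumes S: "S \<in> sets borel" and a: "S \<subseteq> {a..}" and d: "0 < d"
    and diff: "\<And>u u' i. u \<in> S \<Longrightarrow> u' \<in> S \<Longrightarrow> 0 < i \<Longrightarrow> u - u' \<noteq> real i * d"
  shows "emeasure lborel S \<le> ennreal d"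
proof -
  define P where "P i = S \<inter> {a + real i * d ..< a + real (Suc i) * d}" for i
  \<comment> \<open>\<open>T i\<close> is \<open>P i\<close> moved back into
    \<open>{a..<a + d}\<close>; by \<open>diff\<close> these translates are disjoint.\<close>
  define T where "T i = (+) (real i * d) -` P i" for i
  have P: "P i \<in> sets borel" for i using S by (simp add: P_def)
  have T: "T i \<in> sets borel" for i
  proof -
    have "(+) (real i * d) \<in> measurable borel borel" by measurable
    from measurable_sets[OF this P[of i]] show ?thesis by (simp add: T_def)
  qed
  have meas: "emeasure lborel (P i) = emeasure lborel (T i)" for i
  proof -
    have "emeasure lborel (P i) = emeasure (distr lborel borel ((+) (real i * d))) (P i)"
      by (simp add: lborel_distr_plus)
    also have "\<dots> = emeasure lborel (T i)"
      by (subst emeasure_distr) (use P in \<open>auto simp: T_def\<close>)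
    finally show ?thesis .
  qed
  have "S \<subseteq> (\<Union>i. P i)"
  proof
    fix u assume u: "u \<in> S"
    define i where "i = nat \<lfloor>(u - a) / d\<rfloor>"
    have "0 \<le> (u - a) / d" using u a d by auto
    then have "real i \<le> (u - a) / d" "(u - a) / d < real i + 1"
      unfolding i_def by linarith+
    then have "u \<in> P i" using u d by (simp add: P_def pos_le_divide_eq pos_divide_less_eq algebra_simps)
    then show "u \<in> (\<Union>i. P i)" by blast
  qed
  then have "emeasure lborel S \<le> emeasure lborel (\<Union>i. P i)"
    using P by (intro emeasure_mono) auto
  also have "\<dots> \<le> (\<Sum>i. emeasure lborel (P i))"
    using P by (intro emeasure_subadditive_countably) auto
  also have "\<dots> = (\<Sum>i. emeasure lborel (T i))" by (simp add: meas)
  also have "\<dots> = emeasure lborel (\<Union>i. T i)"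
  proof (rule suminf_emeasure)
    show "range T \<subseteq> sets lborel" using T by auto
    have "T i \<inter> T j = {}" if "i < j" for i j
    proof (rule ccontr)
      assume "T i \<inter> T j \<noteq> {}"
      then obtain x where "real i * d + x \<in> S" "real j * d + x \<in> S" by (auto simp: T_def P_def)
      moreover have "real j * d + x - (real i * d + x) = real (j - i) * d"
        using that by (simp add: of_nat_diff algebra_simps)
      ultimately show False using diff[of "real j * d + x" "real i * d + x" "j - i"] that by simp
    qed
    then show "disjoint_family T" unfolding disjoint_family_on_def
      by (metis inf_commute linorder_neqE_nat)
  qed
  also have "\<dots> \<le> emeasure lborel {a..<a + d}"
    by (rule emeasure_mono) (auto simp: T_def P_def algebra_simps)
  also have "\<dots> = ennreal d" using d by simp
  finally show ?thesis .
qed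

text \<open>The exponent is quadratic so that the amplitude \<open>2\<^sup>-\<^sup>k\<close> of the \<open>k\<close>-th wave is eventually larger
  than \<open>rho (k - 1) powr e\<close> for every \<open>e > 0\<close>.\<close>

definition rho :: "nat \<Rightarrow> real" where "rho k = (1/2) ^ ((k + 1)\<^sup>2)"

lemma rho_pos: "0 < rho k" and rho_le1: "rho k \<le> 1"
  by (auto simp: rho_def power_le_one)

lemma rho_antimono: "j \<le> k \<Longrightarrow> rho k \<le> rho j"
  unfolding rho_def by (intro power_decreasing power_mono) auto

definition wave_low :: "(nat \<Rightarrow> nat) \<Rightarrow> nat \<Rightarrow> real \<Rightarrow> real" where
  "wave_low p k u = (\<Sum>j<k. (1/2) ^ j * tri (2 ^ p j * u))"

text \<open>The tail includes index \<open>k\<close>, so that \<open>wave_tail p 0\<close> is the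
  whole sum and the \<open>k\<close>-th wave stands between \<open>wave_low p k\<close> and
  \<open>wave_tail p (Suc k)\<close>.\<close>

definition wave_tail :: "(nat \<Rightarrow> nat) \<Rightarrow> nat \<Rightarrow> real \<Rightarrow> real" where
  "wave_tail p k u = (\<Sum>i. (1/2) ^ (i + k) * tri (2 ^ p (i + k) * u))"

abbreviation wave :: "(nat \<Rightarrow> nat) \<Rightarrow> real \<Rightarrow> real" where
  "wave p \<equiv> wave_tail p 0"

lemma wave_norm_bound: "norm ((1/2) ^ (i + k) * tri (2 ^ p (i + k) * u)) \<le> (1/2) ^ i"
proof -
  have "\<bar>(1/2) ^ (i + k) * tri (2 ^ p (i + k) * u)\<bar> \<le> (1/2) ^ i * 1"
    unfolding abs_mult using tri_bounds[of "2 ^ p (i + k) * u"]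
    by (intro mult_mono) (auto intro: power_decreasing)
  then show ?thesis by simp
qed

lemma summable_wave: "summable (\<lambda>i. (1/2) ^ (i + k) * tri (2 ^ p (i + k) * u))"
  by (rule summable_comparison_test'[of "\<lambda>i. (1/2) ^ i" 0]) (use wave_norm_bound in auto)

lemma continuous_tri: "continuous_on UNIV tri"
  unfolding continuous_on_iff using tri_lipschitz by (metis UNIV_I dist_real_def order_le_less_trans)

lemma continuous_wave_tail: "continuous_on UNIV (wave_tail p k)"
proof -
  have "uniform_limit UNIV (\<lambda>n u. \<Sum>i<n. (1/2) ^ (i + k) * tri (2 ^ p (i + k) * u)) (wave_tail p k) sequentially"
    unfolding wave_tail_def
    by (rule Weierstrass_m_test[of _ _ "\<lambda>i. (1/2) ^ i"]) (use wave_norm_bound in auto)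
  moreover have "continuous_on UNIV (\<lambda>u. tri (2 ^ p i * u))" for i
    by (rule continuous_on_compose2[OF continuous_tri]) (auto intro!: continuous_intros)
  ultimately show ?thesis
    by (intro uniform_limit_theorem) (auto intro!: continuous_intros always_eventually)
qed

lemma wave_split:
  "wave p u = wave_low p k u + (1/2) ^ k * tri (2 ^ p k * u) + wave_tail p (Suc k) u"
proof -
  have "wave p u = wave_tail p (Suc k) u + (\<Sum>i<Suc k. (1/2) ^ i * tri (2 ^ p i * u))"
    using suminf_split_initial_segment[OF summable_wave[of 0 p u], of "Suc k"]
    by (simp add: wave_tail_def)
  then show ?thesis by (simp add: wave_low_def)
qed

text \<open>Under this growth the first \<open>k\<close> waves vary by at most \<open>rho k\<close>
  over a period \<open>2 ^ - p k\<close> of the \<open>k\<close>-th one, and the next period is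
  shorter by at least the factor \<open>rho (Suc k) / 2\<close>.\<close>

locale rapid =
  fixes p :: "nat \<Rightarrow> nat"
  assumes rapid: "2 * 2 ^ p k \<le> rho (Suc k) * 2 ^ p (Suc k)"
begin

lemma p_less_Suc: "p k < p (Suc k)"
proof -
  have "rho (Suc k) * 2 ^ p (Suc k) \<le> 1 * 2 ^ p (Suc k)" by (intro mult_right_mono rho_le1) auto
  then have "(2::real) ^ Suc (p k) \<le> 2 ^ p (Suc k)"
    using rapid[of k] unfolding power_Suc by linarith
  then show ?thesis by (subst (asm) power_increasing_iff) auto
qed

lemma p_mono: "j \<le> k \<Longrightarrow> p j \<le> p k"
  using lift_Suc_mono_le[of p] p_less_Suc by (simp add: less_imp_le)

lemma wave_low_lipschitz: "\<bar>wave_low p k u - wave_low p k v\<bar> \<le> rho k * 2 ^ p k * \<bar>u - v\<bar>"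
proof -
  have sum: "(\<Sum>j<k. (1/2) ^ j * 2 ^ p j) \<le> rho k * 2 ^ p k" for k
  proof (induction k)
    case (Suc k)
    \<comment> \<open>The previous sum and the new term are each at most \<open>2 ^ p k\<close>; the
      factor 2 in \<open>rapid\<close> accounts for both.\<close>
    have "(1/2) ^ k * 2 ^ p k \<le> 1 * (2 ^ p k :: real)" by (intro mult_right_mono power_le_one) auto
    moreover have "rho k * 2 ^ p k \<le> 1 * 2 ^ p k" by (intro mult_right_mono rho_le1) auto
    ultimately show ?case using Suc rapid[of k] unfolding sum.lessThan_Suc by linarith
  qed (simp add: rho_def)
  have "\<bar>wave_low p k u - wave_low p k v\<bar> \<le> (\<Sum>j<k. \<bar>(1/2) ^ j * tri (2 ^ p j * u) - (1/2) ^ j * tri (2 ^ p j * v)\<bar>)"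
    unfolding wave_low_def sum_subtractf[symmetric] by (rule sum_abs)
  also have "\<dots> \<le> (\<Sum>j<k. (1/2) ^ j * 2 ^ p j * \<bar>u - v\<bar>)"
  proof (rule sum_mono)
    fix j
    have "\<bar>tri (2 ^ p j * u) - tri (2 ^ p j * v)\<bar> \<le> 2 ^ p j * \<bar>u - v\<bar>"
      using tri_lipschitz[of "2 ^ p j * u" "2 ^ p j * v"] by (simp add: right_diff_distrib[symmetric] abs_mult)
    then have "(1/2) ^ j * \<bar>tri (2 ^ p j * u) - tri (2 ^ p j * v)\<bar> \<le> (1/2) ^ j * (2 ^ p j * \<bar>u - v\<bar>)"
      by (intro mult_left_mono) auto
    then show "\<bar>(1/2) ^ j * tri (2 ^ p j * u) - (1/2) ^ j * tri (2 ^ p j * v)\<bar> \<le> (1/2) ^ j * 2 ^ p j * \<bar>u - v\<bar>"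
      by (simp add: right_diff_distrib[symmetric] abs_mult mult.assoc)
  qed
  also have "\<dots> = (\<Sum>j<k. (1/2) ^ j * 2 ^ p j) * \<bar>u - v\<bar>" by (simp add: sum_distrib_right)
  also have "\<dots> \<le> rho k * 2 ^ p k * \<bar>u - v\<bar>" by (intro mult_right_mono sum) auto
  finally show ?thesis .
qed

text \<open>The frequencies are powers of 2 and \<open>p\<close> is monotone, so every later
  frequency is an integer multiple of \<open>2 ^ p k\<close>.\<close>

lemma wave_tail_periodic: "wave_tail p k (u + of_int m / 2 ^ p k) = wave_tail p k u"
proof -
  have "tri (2 ^ p (i + k) * (u + of_int m / 2 ^ p k)) = tri (2 ^ p (i + k) * u)" for i
  proof -
    have "(2::real) ^ p (i + k) = 2 ^ (p (i + k) - p k) * 2 ^ p k"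
      using p_mono[of k "i + k"] by (simp add: power_add[symmetric])
    then have "2 ^ p (i + k) * (u + of_int m / 2 ^ p k) = 2 ^ p (i + k) * u + of_int (2 ^ (p (i + k) - p k) * m)"
      by (simp add: distrib_left)
    then show ?thesis by (metis tri_add_int)
  qed
  then show ?thesis by (simp add: wave_tail_def)
qed

text \<open>The range of \<open>u\<close> is half a period of the \<open>k\<close>-th wave. The
  tolerance \<open>3 * r\<close> collects three errors of size \<open>r\<close>: the height of the
  window, the variation of \<open>f\<close> and that of \<open>wave_low p k\<close>.\<close>

definition wave_window :: "nat \<Rightarrow> real \<Rightarrow> real \<Rightarrow> int \<Rightarrow> real set" where
  "wave_window k r y j = {u \<in> {of_int j / 2 ^ Suc (p k) .. (of_int j + 1) / 2 ^ Suc (p k)}.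
     \<bar>(1/2) ^ k * tri (2 ^ p k * u) + wave_tail p (Suc k) u - y\<bar> \<le> 3 * r}"

lemma closed_wave_window: "closed (wave_window k r y j)"
proof -
  have "continuous_on UNIV (\<lambda>u. tri (2 ^ p k * u))"
    by (rule continuous_on_compose2[OF continuous_tri]) (auto intro!: continuous_intros)
  then have "closed {u. \<bar>(1/2) ^ k * tri (2 ^ p k * u) + wave_tail p (Suc k) u - y\<bar> \<le> 3 * r}"
    by (intro closed_Collect_le continuous_intros continuous_wave_tail) auto
  then have "closed ({of_int j / 2 ^ Suc (p k) .. (of_int j + 1) / 2 ^ Suc (p k)} \<inter>
      {u. \<bar>(1/2) ^ k * tri (2 ^ p k * u) + wave_tail p (Suc k) u - y\<bar> \<le> 3 * r})"
    by (intro closed_Int) auto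
  moreover have "wave_window k r y j = {of_int j / 2 ^ Suc (p k) .. (of_int j + 1) / 2 ^ Suc (p k)} \<inter>
      {u. \<bar>(1/2) ^ k * tri (2 ^ p k * u) + wave_tail p (Suc k) u - y\<bar> \<le> 3 * r}"
    by (auto simp: wave_window_def)
  ultimately show ?thesis by simp
qed

text \<open>The tail has period \<open>2 ^ - p (Suc k)\<close>, so between points of the window differing by a multiple of
  this period only the \<open>k\<close>-th wave changes, and it is linear there: such points are close to each
  other. This dispenses with any independence argument for the tail.\<close>

lemma emeasure_wave_window:
  assumes "rho k \<le> r"
  shows "emeasure lborel (wave_window k r y j) \<le> ennreal (7 * r * 2 ^ k / 2 ^ p k)"
proof -
  have r: "0 < r" using assms rho_pos[of k] by linarith
  \<comment> \<open>Heights in the window differ by at most \<open>6 * r\<close> and the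
    \<open>k\<close>-th wave has slope \<open>2 ^ p k / 2 ^ k\<close> up to sign, so points with
    equal tails are at most \<open>b\<close> apart. \<open>d\<close> is the first multiple of the
    next period above \<open>b\<close>.\<close>
  define b where "b = 6 * r * 2 ^ k / 2 ^ p k"
  define m where "m = nat \<lfloor>b * 2 ^ p (Suc k)\<rfloor> + 1"
  define d where "d = real m / 2 ^ p (Suc k)"
  have b: "0 < b" using r by (simp add: b_def)
  have m: "b * 2 ^ p (Suc k) < real m" "real m \<le> b * 2 ^ p (Suc k) + 1"
  proof -
    have "0 \<le> b * 2 ^ p (Suc k)" using b by simp
    then show "b * 2 ^ p (Suc k) < real m" "real m \<le> b * 2 ^ p (Suc k) + 1"
      unfolding m_def by linarith+
  qed
  have bd: "b < d" using m by (simp add: d_def pos_less_divide_eq)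
  have "d \<le> b + 1 / 2 ^ p (Suc k)" using m by (simp add: d_def field_simps)
  \<comment> \<open>Rounding up to \<open>d\<close> costs at most one period, hence at most a sixth
    of \<open>b\<close>; this turns 6 into 7.\<close>
  moreover have "1 / 2 ^ p (Suc k) \<le> r * 2 ^ k / 2 ^ p k"
  proof -
    have "2 ^ p k \<le> rho (Suc k) * 2 ^ p (Suc k)" using rapid[of k] zero_less_power[of "2::real" "p k"] by linarith
    also have "\<dots> \<le> r * 2 ^ p (Suc k)" using rho_antimono[of k "Suc k"] assms by (intro mult_right_mono) auto
    also have "\<dots> \<le> (r * 2 ^ k) * 2 ^ p (Suc k)" using r by (simp add: mult_le_cancel_left1)
    finally show ?thesis by (simp add: divide_simps mult.commute)
  qed
  moreover have "b + r * 2 ^ k / 2 ^ p k = 7 * r * 2 ^ k / 2 ^ p k"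
    unfolding b_def add_divide_distrib[symmetric] by simp
  ultimately have d: "d \<le> 7 * r * 2 ^ k / 2 ^ p k" by linarith
  let ?S = "wave_window k r y j"
  have "emeasure lborel ?S \<le> ennreal d"
  proof (rule emeasure_le_no_multiple_differences)
    show "?S \<in> sets borel" using closed_wave_window by (rule borel_closed)
    show "?S \<subseteq> {of_int j / 2 ^ Suc (p k)..}" by (auto simp: wave_window_def)
    show "0 < d" using b bd by linarith
    fix u u' i assume u: "u \<in> ?S" and u': "u' \<in> ?S" and i: "0 < (i::nat)"
    show "u - u' \<noteq> real i * d"
    proof
      assume eq: "u - u' = real i * d"
      have "u = u' + of_int (int (i * m)) / 2 ^ p (Suc k)" using eq by (simp add: d_def)
      then have "wave_tail p (Suc k) u = wave_tail p (Suc k) u'" by (metis wave_tail_periodic)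
      moreover have "\<bar>tri (2 ^ p k * u) - tri (2 ^ p k * u')\<bar> = \<bar>2 ^ p k * u - 2 ^ p k * u'\<bar>"
        using u u' by (intro tri_isometry[of j]) (auto simp: wave_window_def field_simps)
      ultimately have "(1/2) ^ k * \<bar>2 ^ p k * u - 2 ^ p k * u'\<bar> \<le> 6 * r"
      proof -
        assume T: "wave_tail p (Suc k) u = wave_tail p (Suc k) u'"
        assume t: "\<bar>tri (2 ^ p k * u) - tri (2 ^ p k * u')\<bar> = \<bar>2 ^ p k * u - 2 ^ p k * u'\<bar>"
        have "\<bar>(1/2) ^ k * tri (2 ^ p k * u) - (1/2) ^ k * tri (2 ^ p k * u')\<bar> \<le> 6 * r"
          using u u' T unfolding wave_window_def by auto
        then show ?thesis unfolding t[symmetric] by (simp add: right_diff_distrib[symmetric] abs_mult)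
      qed
      moreover have "\<bar>2 ^ p k * u - 2 ^ p k * u'\<bar> = 2 ^ p k * \<bar>u - u'\<bar>"
        by (simp add: right_diff_distrib[symmetric] abs_mult)
      ultimately have "2 ^ p k * \<bar>u - u'\<bar> \<le> 6 * r * 2 ^ k"
        by (simp add: power_one_over divide_le_eq)
      then have "\<bar>u - u'\<bar> \<le> b" by (simp add: b_def field_simps)
      moreover have "d \<le> real i * d" using i b bd by (simp add: mult_le_cancel_right1)
      ultimately show False using eq b bd by simp
    qed
  qed
  also have "ennreal d \<le> ennreal (7 * r * 2 ^ k / 2 ^ p k)" using d by (rule ennreal_leI)
  finally show ?thesis .
qed

end

section \<open>Lower bound for the dimension\<close>

text \<open>\<open>2 * l powr (s - 1) = 1\<close> is the equation for the similarity dimension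
  \<open>s - 1\<close> of the Cantor set.\<close>

locale cantor_dim = cantor_ratio l for l +
  fixes s :: real
  assumes s1: "1 < s" and s2: "s \<le> 2" and l_powr: "l powr (s - 1) = 1/2"
begin

lemma l_power_powr: "(l ^ p) powr (s - 1) = (1/2) ^ p"
proof -
  have "(l ^ p) powr (s - 1) = (l powr (s - 1)) powr real p"
    using l0 by (simp add: powr_realpow[symmetric] powr_powr mult.commute)
  then show ?thesis by (simp add: l_powr powr_realpow)
qed

lemma scale_exists:
  assumes "0 < r" "r < 1"
  obtains p where "l ^ Suc p \<le> r" "r < l ^ p"
proof -
  define q where "q = (LEAST q. l ^ q \<le> r)"
  have "\<exists>q. l ^ q \<le> r" using power_to_0[OF assms(1)] less_imp_le by blast
  then have q: "l ^ q \<le> r" unfolding q_def by (rule LeastI_ex)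
  then have "q \<noteq> 0" using assms by (cases q) auto
  then obtain p where p: "q = Suc p" using not0_implies_Suc by blast
  have "\<not> l ^ p \<le> r" using not_less_Least[of p "\<lambda>q. l ^ q \<le> r"] p q_def by simp
  then show ?thesis using that[of p] q p by simp
qed

lemma half_power_le: "l ^ p \<le> r \<Longrightarrow> (1/2) ^ p \<le> r powr (s - 1)"
  using powr_mono2[of "s - 1" "l ^ p" r] s1 l0 by (simp add: l_power_powr)

lemma half_power_ge: "0 \<le> r \<Longrightarrow> r \<le> l ^ p \<Longrightarrow> r powr (s - 1) \<le> (1/2) ^ p"
  using powr_mono2[of "s - 1" r "l ^ p"] s1 by (simp add: l_power_powr)

lemma cantor_holder:
  assumes "\<bar>x - y\<bar> \<le> r" "0 < r" "r < 1"
  shows "\<bar>C x - C y\<bar> \<le> 4 * r powr (s - 1)"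
proof -
  obtain p where p: "l ^ Suc p \<le> r" "r < l ^ p" using scale_exists assms by blast
  have "\<bar>C x - C y\<bar> \<le> 2 * (1/2) ^ p" using assms p by (intro cantor_dist_le) linarith
  also have "\<dots> = 4 * (1/2) ^ Suc p" by simp
  also have "\<dots> \<le> 4 * r powr (s - 1)" using half_power_le[OF p(1)] by simp
  finally show ?thesis .
qed

end

text \<open>The upper bound is \<open>rho (k - 1)\<close> written out, for the least
  \<open>k\<close> with \<open>rho k \<le> r\<close>.\<close>

lemma rho_between:
  assumes "0 < r" "r < rho K"
  obtains k where "K < k" "rho k \<le> r" "r < (1/2) ^ k\<^sup>2"
proof -
  define k where "k = (LEAST k. rho k \<le> r)"
  obtain n where n: "(1/2::real) ^ n < r" using real_arch_pow_inv[of r "1/2"] assms by auto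
  have "rho n \<le> (1/2) ^ n" unfolding rho_def by (intro power_decreasing) (auto simp: power2_eq_square)
  then have "\<exists>k. rho k \<le> r" using n by (intro exI[of _ n]) linarith
  then have k: "rho k \<le> r" unfolding k_def by (rule LeastI_ex)
  have "K < k" using rho_antimono[of k K] k assms by (meson linorder_not_less order_le_less_trans order_less_irrefl)
  then have "\<not> rho (k - 1) \<le> r" using not_less_Least[of "k - 1" "\<lambda>k. rho k \<le> r"] k_def by simp
  then show ?thesis using that[of k] k \<open>K < k\<close> by (simp add: rho_def)
qed

text \<open>By \<open>p_rho\<close> the construction intervals of level \<open>p k\<close> are no
  longer than any scale \<open>r \<ge> rho k\<close>, so rounding the number of cells met costs only
  a constant factor.\<close>

locale cantor_wave = cantor_dim l s + rapid p for l s p +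
  assumes p_rho: "l ^ p k \<le> rho k"
begin

text \<open>The horizontal restriction leaves parameters \<open>C x\<close> in an interval of length
  about \<open>r powr (s - 1)\<close>; in each half period of the \<open>k\<close>-th wave only a
  proportion of about \<open>r * 2 ^ k\<close> has the right height.\<close>

lemma window_cover:
  fixes f :: "real \<Rightarrow> real"
  assumes f: "\<And>x y. x \<in> {0..1} \<Longrightarrow> y \<in> {0..1} \<Longrightarrow> \<bar>x - y\<bar> \<le> l ^ Suc (p k) \<Longrightarrow> \<bar>f x - f y\<bar> \<le> rho k"
    and r: "rho k \<le> r" "r < 1"
  obtains V where "V \<in> sets borel" "emeasure lborel V \<le> ennreal (126 * 2 ^ k * r powr s)"
    "{C x | x. x \<in> {0..1} \<and> \<bar>x - x0\<bar> \<le> r \<and> \<bar>f x + wave p (C x) - y\<bar> \<le> r} \<subseteq> V"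
proof -
  define q where "q = Suc (p k)"
  have r0: "0 < r" using rho_pos[of k] r by linarith
  define N where "N = 2 ^ q * r powr (s - 1)"
  have N2: "2 \<le> N"
  proof -
    have "(1/2) ^ p k \<le> r powr (s - 1)" using p_rho[of k] r by (intro half_power_le) linarith
    then have "2 ^ q * (1/2) ^ p k \<le> N" unfolding N_def by (intro mult_left_mono) auto
    then show ?thesis by (simp add: q_def power_one_over)
  qed
  define I where "I = {\<lfloor>2 ^ q * C x0 - 4 * N\<rfloor> .. \<lfloor>2 ^ q * C x0 + 4 * N\<rfloor>}"
  \<comment> \<open>There are at most \<open>8 * N + 2\<close> indices, and
    \<open>2 \<le> N\<close>.\<close>
  have cardI: "real (card I) \<le> 9 * N" unfolding I_def using N2 by simp linarith
  define in_cell where "in_cell j x \<longleftrightarrow> x \<in> {0..1} \<and> of_int j < 2 ^ q * C x \<and> 2 ^ q * C x < of_int j + 1" for j :: int and x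
  \<comment> \<open>A sample point of the cell, at which \<open>f\<close> and
    \<open>wave_low p k\<close> are frozen to give the target height \<open>Y j\<close>. For an
    empty cell its value is arbitrary and harmless.\<close>
  define z where "z j = (SOME x. in_cell j x)" for j
  define Y where "Y j = y - f (z j) - wave_low p k (C (z j))" for j
  \<comment> \<open>Endpoints of cells, where \<open>cantor_inverse_dist\<close> does not apply,
    form a countable and hence null set.\<close>
  define V where "V = range (\<lambda>j::int. of_int j / 2 ^ q) \<union> (\<Union>j\<in>I. wave_window k r (Y j) j)"
  show ?thesis
  proof
    have cnt: "countable (range (\<lambda>j::int. of_int j / 2 ^ q :: real))" by simp
    have W: "wave_window k r (Y j) j \<in> sets borel" for j
      using closed_wave_window by (rule borel_closed)
    have D: "range (\<lambda>j::int. of_int j / 2 ^ q :: real) \<in> sets borel"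
      by (rule sets.countable[OF _ cnt]) simp
    have UW: "(\<Union>j\<in>I. wave_window k r (Y j) j) \<in> sets borel"
      by (rule sets.finite_UN) (simp_all add: I_def W)
    show "V \<in> sets borel" unfolding V_def using D UW by (rule sets.Un)
    have "emeasure lborel V \<le> emeasure lborel (range (\<lambda>j::int. of_int j / 2 ^ q :: real)) +
       emeasure lborel (\<Union>j\<in>I. wave_window k r (Y j) j)"
      unfolding V_def using D UW by (intro emeasure_subadditive) simp_all
    also have "\<dots> \<le> 0 + (\<Sum>j\<in>I. emeasure lborel (wave_window k r (Y j) j))"
      using W emeasure_lborel_countable[OF cnt]
      by (intro add_mono emeasure_subadditive_finite) (auto simp: I_def)
    also have "\<dots> \<le> (\<Sum>j\<in>I. ennreal (7 * r * 2 ^ k / 2 ^ p k))"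
      unfolding add_0 by (intro sum_mono emeasure_wave_window r)
    also have "\<dots> = ennreal (real (card I) * (7 * r * 2 ^ k / 2 ^ p k))"
      by (subst ennreal_mult) (use r0 in \<open>auto simp: ennreal_of_nat_eq_real_of_nat\<close>)
    also have "\<dots> \<le> ennreal (9 * N * (7 * r * 2 ^ k / 2 ^ p k))"
      using cardI r0 by (intro ennreal_leI mult_right_mono) auto
    also have "9 * N * (7 * r * 2 ^ k / 2 ^ p k) = 126 * 2 ^ k * (r powr (s - 1) * r powr 1)"
    proof -
      have "9 * (2 * P * R) * (7 * r * K / P) = 126 * K * (R * r)" if "P \<noteq> 0" for P R K :: real
        using that by simp
      then show ?thesis using r0 by (simp only: N_def q_def power_Suc powr_one) simp
    qed
    also have "r powr (s - 1) * r powr 1 = r powr s" by (simp only: powr_add[symmetric]) simp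
    finally show "emeasure lborel V \<le> ennreal (126 * 2 ^ k * r powr s)" .
    show "{C x | x. x \<in> {0..1} \<and> \<bar>x - x0\<bar> \<le> r \<and> \<bar>f x + wave p (C x) - y\<bar> \<le> r} \<subseteq> V"
    proof clarify
      fix x assume x: "x \<in> {0..1}" and xx0: "\<bar>x - x0\<bar> \<le> r" and yy: "\<bar>f x + wave p (C x) - y\<bar> \<le> r"
      define j where "j = \<lfloor>2 ^ q * C x\<rfloor>"
      show "C x \<in> V"
      proof (cases "2 ^ q * C x = of_int j")
        case True
        then have "C x = of_int j / 2 ^ q" by (simp add: eq_divide_eq mult.commute)
        then show ?thesis by (auto simp: V_def)
      next
        case False
        have fl: "of_int j \<le> 2 ^ q * C x" "2 ^ q * C x < of_int j + 1" by (auto simp: j_def)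
        then have cell: "in_cell j x" using False x unfolding in_cell_def by auto
        then have zc: "in_cell j (z j)" unfolding z_def by (rule someI)
        have "\<bar>C x - C x0\<bar> \<le> 4 * r powr (s - 1)" using xx0 r0 r by (intro cantor_holder) auto
        then have "2 ^ q * \<bar>C x - C x0\<bar> \<le> 2 ^ q * (4 * r powr (s - 1))" by (intro mult_left_mono) auto
        moreover have "2 ^ q * \<bar>C x - C x0\<bar> = \<bar>2 ^ q * C x - 2 ^ q * C x0\<bar>"
          by (simp add: right_diff_distrib[symmetric] abs_mult)
        ultimately have "\<bar>2 ^ q * C x - 2 ^ q * C x0\<bar> \<le> 4 * N" by (simp add: N_def)
        then have jI: "j \<in> I" unfolding I_def j_def by (auto intro!: floor_mono)
        have "\<bar>x - z j\<bar> \<le> l ^ q" using cell zc unfolding in_cell_def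
          by (intro cantor_inverse_dist[of j]) auto
        then have fz: "\<bar>f x - f (z j)\<bar> \<le> r" using f[of x "z j"] x zc r
          unfolding in_cell_def q_def by linarith
        have "\<bar>2 ^ q * C x - 2 ^ q * C (z j)\<bar> \<le> 1" using cell zc unfolding in_cell_def by linarith
        then have "2 ^ p k * \<bar>C x - C (z j)\<bar> \<le> 1"
          by (simp add: right_diff_distrib[symmetric] abs_mult q_def)
        then have "rho k * (2 ^ p k * \<bar>C x - C (z j)\<bar>) \<le> rho k * 1"
          using rho_pos[of k] by (intro mult_left_mono) auto
        then have low: "\<bar>wave_low p k (C x) - wave_low p k (C (z j))\<bar> \<le> r"
          using wave_low_lipschitz[of k "C x" "C (z j)"] r by (simp add: mult.assoc)
        have "C x \<in> {of_int j / 2 ^ Suc (p k) .. (of_int j + 1) / 2 ^ Suc (p k)}"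
          using fl unfolding q_def by (auto simp: divide_le_eq le_divide_eq mult.commute)
        moreover have "\<bar>(1/2) ^ k * tri (2 ^ p k * C x) + wave_tail p (Suc k) (C x) - Y j\<bar> \<le> 3 * r"
          using yy fz low wave_split[of p "C x" k] unfolding Y_def by linarith
        ultimately have "C x \<in> wave_window k r (Y j) j" unfolding wave_window_def by simp
        then show ?thesis using jI by (auto simp: V_def)
      qed
    qed
  qed
qed

text \<open>Lowering the exponent pays for the factor \<open>2 ^ k\<close>: from
  \<open>r < (1/2) ^ k\<^sup>2\<close> follows \<open>r powr (s - t) \<le> 1 / 2 ^ k\<close> as soon
  as \<open>k \<ge> 1 / (s - t)\<close>.\<close>

lemma window_measure:
  fixes f :: "real \<Rightarrow> real"
  assumes f: "\<And>k x y. K \<le> k \<Longrightarrow> x \<in> {0..1} \<Longrightarrow> y \<in> {0..1} \<Longrightarrow> \<bar>x - y\<bar> \<le> l ^ Suc (p k) \<Longrightarrow> \<bar>f x - f y\<bar> \<le> rho k"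
    and t: "t < s"
  shows "\<exists>r0>0. \<forall>r x0 y. 0 < r \<longrightarrow> r < r0 \<longrightarrow>
    (\<exists>V. V \<in> sets borel \<and> emeasure lborel V \<le> ennreal (126 * r powr t) \<and>
    {C x | x. x \<in> {0..1} \<and> \<bar>x - x0\<bar> \<le> r \<and> \<bar>f x + wave p (C x) - y\<bar> \<le> r} \<subseteq> V)"
proof -
  define e where "e = s - t"
  have e: "0 < e" using t by (simp add: e_def)
  obtain K' :: nat where K': "1 / e \<le> real K'" using real_arch_simple by blast
  show ?thesis
  proof (intro exI[of _ "rho (max K K')"] conjI allI impI)
    show "0 < rho (max K K')" by (rule rho_pos)
    fix r x0 y :: real assume r: "0 < r" "r < rho (max K K')"
    obtain k where k: "max K K' < k" "rho k \<le> r" "r < (1/2) ^ k\<^sup>2" using rho_between[OF r] by blast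
    have r1: "r < 1" using r rho_le1[of "max K K'"] by linarith
    have pw: "2 ^ k * r powr s \<le> r powr t"
    proof -
      have "1 / e \<le> real k" using K' k by linarith
      then have "1 \<le> real k * e" using e by (simp add: divide_le_eq)
      then have ke: "real k \<le> real (k\<^sup>2) * e"
        using mult_left_mono[of 1 "real k * e" "real k"] by (simp add: power2_eq_square mult.assoc)
      have "r powr e \<le> ((1/2) ^ k\<^sup>2) powr e" using r k e by (intro powr_mono2) auto
      also have "\<dots> = (1/2) powr (real (k\<^sup>2) * e)"
        by (simp add: powr_realpow[symmetric] powr_powr)
      also have "\<dots> \<le> (1/2) powr real k" using ke by (intro powr_mono') auto
      also have "\<dots> = 1 / 2 ^ k" by (simp add: powr_realpow power_one_over)
      finally have "2 ^ k * r powr e \<le> 1" by (simp add: field_simps)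
      then have "(2 ^ k * r powr e) * r powr t \<le> 1 * r powr t" by (intro mult_right_mono) auto
      moreover have "r powr e * r powr t = r powr s" by (simp add: powr_add[symmetric] e_def)
      ultimately show ?thesis by (simp add: mult.assoc)
    qed
    obtain V where V: "V \<in> sets borel" "emeasure lborel V \<le> ennreal (126 * 2 ^ k * r powr s)"
      "{C x | x. x \<in> {0..1} \<and> \<bar>x - x0\<bar> \<le> r \<and> \<bar>f x + wave p (C x) - y\<bar> \<le> r} \<subseteq> V"
      by (rule window_cover[of k f r x0 y]) (use f[of k] k r1 in auto)
    have "emeasure lborel V \<le> ennreal (126 * r powr t)"
      using pw by (intro order_trans[OF V(2)] ennreal_leI) auto
    then show "\<exists>V. V \<in> sets borel \<and> emeasure lborel V \<le> ennreal (126 * r powr t) \<and>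
      {C x | x. x \<in> {0..1} \<and> \<bar>x - x0\<bar> \<le> r \<and> \<bar>f x + wave p (C x) - y\<bar> \<le> r} \<subseteq> V"
      using V by blast
  qed
qed

text \<open>Each set of a cover is weighed by a Borel set containing the parameters
  \<open>C x\<close> of its graph points. Since \<open>C\<close> is onto, these Borel sets cover
  \<open>{0..1}\<close>, so their measures sum to at least 1.\<close>

lemma mass_ge_graph:
  fixes f F :: "real \<Rightarrow> real"
  assumes f: "\<And>k x y. K \<le> k \<Longrightarrow> x \<in> {0..1} \<Longrightarrow> y \<in> {0..1} \<Longrightarrow> \<bar>x - y\<bar> \<le> l ^ Suc (p k) \<Longrightarrow> \<bar>f x - f y\<bar> \<le> rho k"
    and t: "0 < t" "t < s" and c: "c \<noteq> 0"
    and F: "\<And>x. x \<in> {0..1} \<Longrightarrow> F x = c * (f x + wave p (C x))"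
  shows "mass_ge t (graph_on F {0..1})"
proof -
  obtain r0 where r0: "0 < r0" and win: "\<And>r x0 y. 0 < r \<Longrightarrow> r < r0 \<Longrightarrow>
    \<exists>V. V \<in> sets borel \<and> emeasure lborel V \<le> ennreal (126 * r powr t) \<and>
    {C x | x. x \<in> {0..1} \<and> \<bar>x - x0\<bar> \<le> r \<and> \<bar>f x + wave p (C x) - y\<bar> \<le> r} \<subseteq> V"
    using window_measure[of K f t] f t(2) by meson
  \<comment> \<open>Division by \<open>c\<close> turns a vertical distance \<open>D\<close> into
    \<open>D / \<bar>c\<bar>\<close>; radius \<open>B * D\<close> allows for both this and the
    horizontal \<open>D\<close>.\<close>
  define B where "B = 1 + 1 / \<bar>c\<bar>"
  have B: "1 \<le> B" "1 / \<bar>c\<bar> \<le> B" by (auto simp: B_def)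
  define A where "A = 126 * B powr t"
  have A: "0 < A" using B by (simp add: A_def)
  have piece: "\<exists>V. V \<in> sets borel \<and> emeasure lborel V \<le> ennreal A * ennreal (diameter U powr t) \<and>
     {C x | x. x \<in> {0..1} \<and> (x, F x) \<in> U} \<subseteq> V"
    if U: "bounded U" "diameter U \<le> r0 / (2 * B)" for U :: "(real \<times> real) set"
  proof (cases "\<exists>x0\<in>{0..1}. (x0, F x0) \<in> U")
    case False
    then show ?thesis by (intro exI[of _ "{}"]) auto
  next
    case True
    then obtain x0 where x0: "x0 \<in> {0..1}" "(x0, F x0) \<in> U" by blast
    define D where "D = diameter U"
    have dist: "\<bar>x - x0\<bar> \<le> D" "\<bar>F x - F x0\<bar> \<le> D" if "(x, F x) \<in> U" for x
      using diameter_bounded_bound[OF U(1) that x0(2)] dist_fst_le[of "(x, F x)" "(x0, F x0)"]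
        dist_snd_le[of "(x, F x)" "(x0, F x0)"] by (auto simp: D_def dist_real_def)
    show ?thesis
    proof (cases "D = 0")
      case True
      \<comment> \<open>Windows need a positive radius, so diameter 0 is separate: a single
        parameter of measure 0.\<close>
      then have "{C x | x. x \<in> {0..1} \<and> (x, F x) \<in> U} \<subseteq> {C x0}" using dist(1) by force
      then show ?thesis by (intro exI[of _ "{C x0}"]) auto
    next
      case False
      then have D: "0 < D" using diameter_ge_0[OF U(1)] by (simp add: D_def)
      define R where "R = B * D"
      have R: "0 < R" "D \<le> R" "D / \<bar>c\<bar> \<le> R"
        using B D mult_right_mono[OF B(1), of D] mult_right_mono[OF B(2), of D] by (auto simp: R_def)
      have "R \<le> r0 / 2" using mult_left_mono[OF U(2), of B] B by (simp add: R_def D_def)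
      then have "R < r0" using r0 by simp
      obtain V where V: "V \<in> sets borel" "emeasure lborel V \<le> ennreal (126 * R powr t)"
        "{C x | x. x \<in> {0..1} \<and> \<bar>x - x0\<bar> \<le> R \<and> \<bar>f x + wave p (C x) - F x0 / c\<bar> \<le> R} \<subseteq> V"
        using win[OF R(1) \<open>R < r0\<close>] by meson
      have "{C x | x. x \<in> {0..1} \<and> (x, F x) \<in> U} \<subseteq> V"
      proof (rule subset_trans[OF _ V(3)], clarify)
        fix x assume x: "x \<in> {0..1}" "(x, F x) \<in> U"
        have "f x + wave p (C x) - F x0 / c = (F x - F x0) / c"
          using F[OF x(1)] c by (simp add: field_simps)
        then have "\<bar>f x + wave p (C x) - F x0 / c\<bar> = \<bar>F x - F x0\<bar> / \<bar>c\<bar>" by simp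
        also have "\<dots> \<le> D / \<bar>c\<bar>" using dist(2)[OF x(2)] by (intro divide_right_mono) auto
        finally show "\<exists>x'. C x = C x' \<and> x' \<in> {0..1} \<and> \<bar>x' - x0\<bar> \<le> R \<and> \<bar>f x' + wave p (C x') - F x0 / c\<bar> \<le> R"
          using x(1) dist(1)[OF x(2)] R by (intro exI[of _ x]) linarith
      qed
      moreover have "126 * R powr t = A * D powr t"
        using B D by (simp add: R_def A_def powr_mult)
      then have "ennreal (126 * R powr t) = ennreal A * ennreal (diameter U powr t)"
        using A by (simp add: ennreal_mult'' D_def)
      ultimately show ?thesis using V by auto
    qed
  qed
  have "ennreal (1 / A) \<le> (\<Sum>i. ennreal (diameter (U i) powr t))"
    if cov: "graph_on F {0..1} \<subseteq> (\<Union>i. U i)"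
      and U: "\<forall>i. bounded (U i) \<and> diameter (U i) \<le> r0 / (2 * B)" for U :: "nat \<Rightarrow> (real \<times> real) set"
  proof -
    have "\<forall>i. \<exists>V. V \<in> sets borel \<and> emeasure lborel V \<le> ennreal A * ennreal (diameter (U i) powr t) \<and>
      {C x | x. x \<in> {0..1} \<and> (x, F x) \<in> U i} \<subseteq> V"
      using piece U by blast
    from choice[OF this] obtain V where "\<forall>i. V i \<in> sets borel \<and>
      emeasure lborel (V i) \<le> ennreal A * ennreal (diameter (U i) powr t) \<and>
      {C x | x. x \<in> {0..1} \<and> (x, F x) \<in> U i} \<subseteq> V i" by (elim exE)
    then have V: "V i \<in> sets borel" "emeasure lborel (V i) \<le> ennreal A * ennreal (diameter (U i) powr t)"
      "{C x | x. x \<in> {0..1} \<and> (x, F x) \<in> U i} \<subseteq> V i" for i by simp_all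
    have "{0..1} \<subseteq> (\<Union>i. V i)"
    proof
      fix u :: real assume "u \<in> {0..1}"
      then obtain x where x: "x \<in> {0..1}" "u = C x" using cantor_surj by (metis imageE)
      then have "(x, F x) \<in> graph_on F {0..1}" by (auto simp: graph_on_def)
      then obtain i where "(x, F x) \<in> U i" using cov by blast
      then show "u \<in> (\<Union>i. V i)" using V(3)[of i] x by blast
    qed
    then have "emeasure lborel {0..1::real} \<le> emeasure lborel (\<Union>i. V i)"
      using V by (intro emeasure_mono) auto
    also have "\<dots> \<le> (\<Sum>i. emeasure lborel (V i))"
      using V by (intro emeasure_subadditive_countably) auto
    also have "\<dots> \<le> (\<Sum>i. ennreal A * ennreal (diameter (U i) powr t))"
      using V by (intro suminf_le summableI) auto
    also have "\<dots> = ennreal A * (\<Sum>i. ennreal (diameter (U i) powr t))"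
      by (rule ennreal_suminf_cmult)
    finally have "1 \<le> ennreal A * (\<Sum>i. ennreal (diameter (U i) powr t))" by simp
    then have "ennreal (1 / A) * 1 \<le> ennreal (1 / A) * (ennreal A * (\<Sum>i. ennreal (diameter (U i) powr t)))"
      by (intro mult_left_mono) auto
    also have "\<dots> = (\<Sum>i. ennreal (diameter (U i) powr t))"
      unfolding mult.assoc[symmetric] using A by (subst ennreal_mult[symmetric]) auto
    finally show ?thesis by simp
  qed
  moreover have "0 < 1 / A" "0 < r0 / (2 * B)" using A r0 B by auto
  ultimately show ?thesis unfolding mass_ge_def by meson
qed

end

section \<open>Upper bound for the box dimension\<close>

context cantor_dim
begin

text \<open>\<open>V\<close> are vertical translates of pieces of the given cover of the graph of \<open>f\<close>; each piece meets at
  most 18 level sets of \<open>C\<close> at multiples of \<open>2 ^ - q\<close>. \<open>S\<close> slices the strips between these level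
  sets, whose width is at most \<open>l ^ q\<close>.\<close>

lemma coverable_add_comp_cantor:
  fixes f F :: "real \<Rightarrow> real"
  assumes F: "\<And>x. x \<in> {0..1} \<Longrightarrow> F x = f x + h (C x)" and M: "\<And>x. x \<in> {0..1} \<Longrightarrow> \<bar>F x\<bar> \<le> M"
    and cov: "coverable \<delta> n (graph_on f {0..1})" and d: "0 < \<delta>" "\<delta> < 1"
  obtains n' where "coverable \<delta> n' (graph_on F {0..1})"
    "real n' \<le> 18 * real n + (16 * M + 8) * \<delta> powr - s"
proof -
  \<comment> \<open>The level is taken for \<open>\<delta> / 2\<close>, so that the slices have
    width and height at most \<open>\<delta> / 2\<close> and hence diameter at most
    \<open>\<delta>\<close>.\<close>
  obtain p where p: "l ^ Suc p \<le> \<delta> / 2" "\<delta> / 2 < l ^ p" using scale_exists[of "\<delta> / 2"] d by auto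
  define q where "q = Suc p"
  have M0: "0 \<le> M" using M[of 0] by fastforce
  define L where "L = nat \<lfloor>4 * M / \<delta>\<rfloor> + 1"
  obtain F0 where F0: "finite F0" "card F0 \<le> n" "graph_on f {0..1} \<subseteq> \<Union>F0"
    "\<And>A. A \<in> F0 \<Longrightarrow> bounded A \<and> diameter A \<le> \<delta>"
    using cov unfolding coverable_def by (elim exE conjE) (rule that, auto)
  \<comment> \<open>The values \<open>2 ^ q * C x\<close> on a piece stay within 8 of that at one
    chosen point. After a shift by 8, the indices below 18 reach every integer level that the piece
    meets.\<close>
  define w where "w A = 2 ^ q * C (fst (SOME z. z \<in> A))" for A :: "(real \<times> real) set"
  define V where "V = (\<lambda>(A, k::nat). {(x, y + h (C x)) | x y. (x, y) \<in> A \<and> 2 ^ q * C x = of_int (\<lfloor>w A\<rfloor> + int k - 8)})"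
  define S where "S = (\<lambda>(j::nat, m::nat). {(x::real, y::real). real j < 2 ^ q * C x \<and> 2 ^ q * C x < real j + 1 \<and>
     real m * (\<delta> / 2) \<le> y + M \<and> y + M \<le> (real m + 1) * (\<delta> / 2)})"
  define Fam where "Fam = V ` (F0 \<times> {..<18}) \<union> S ` ({..<2 ^ q} \<times> {..<L})"
  have "coverable \<delta> (18 * n + 2 ^ q * L) (graph_on F {0..1})"
    unfolding coverable_def
  proof (intro exI[of _ Fam] conjI ballI)
    show "finite Fam" unfolding Fam_def using F0(1) by auto
    have "card Fam \<le> card (V ` (F0 \<times> {..<18::nat})) + card (S ` ({..<2 ^ q} \<times> {..<L}))"
      unfolding Fam_def by (rule card_Un_le)
    also have "\<dots> \<le> card (F0 \<times> {..<18::nat}) + card ({..<(2::nat) ^ q} \<times> {..<L})"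
      by (intro add_mono card_image_le) (use F0(1) in auto)
    also have "\<dots> \<le> 18 * n + 2 ^ q * L" using F0(2) by (simp add: card_cartesian_product)
    finally show "card Fam \<le> 18 * n + 2 ^ q * L" .
    show "graph_on F {0..1} \<subseteq> \<Union>Fam"
    proof
      fix z assume "z \<in> graph_on F {0..1}"
      then obtain x where x: "x \<in> {0..1}" "z = (x, F x)" by (auto simp: graph_on_def)
      define i where "i = \<lfloor>2 ^ q * C x\<rfloor>"
      have i: "of_int i \<le> 2 ^ q * C x" "2 ^ q * C x < of_int i + 1" unfolding i_def by linarith+
      show "z \<in> \<Union>Fam"
      proof (cases "2 ^ q * C x = of_int i")
        case True
        have "(x, f x) \<in> graph_on f {0..1}" using x by (auto simp: graph_on_def)
        then obtain A where A: "A \<in> F0" "(x, f x) \<in> A" using F0(3) by blast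
        define u where "u = (SOME z. z \<in> A)"
        have u: "u \<in> A" unfolding u_def using A(2) by (rule someI)
        have "dist (x, f x) u \<le> \<delta>"
          using diameter_bounded_bound[of A "(x, f x)" u] F0(4)[OF A(1)] A(2) u by linarith
        then have xu: "\<bar>x - fst u\<bar> \<le> \<delta>" using dist_fst_le[of "(x, f x)" u] by (simp add: dist_real_def)
        \<comment> \<open>The points may be \<open>\<delta>\<close> apart while only
          \<open>\<delta> / 2 < l ^ p\<close> is known; the midpoint bridges this.\<close>
        define mid where "mid = (x + fst u) / 2"
        have "\<bar>x - mid\<bar> \<le> l ^ p" "\<bar>mid - fst u\<bar> \<le> l ^ p"
          using xu p(2) unfolding mid_def by (auto simp: field_simps)
        then have "\<bar>C x - C (fst u)\<bar> \<le> 4 * (1/2) ^ p"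
          using cantor_dist_le[of x mid p] cantor_dist_le[of mid "fst u" p] by linarith
        then have "2 ^ q * \<bar>C x - C (fst u)\<bar> \<le> 2 ^ q * (4 * (1/2) ^ p)" by (intro mult_left_mono) auto
        also have "\<dots> = 8" by (simp add: q_def power_one_over)
        finally have "\<bar>2 ^ q * C x - w A\<bar> \<le> 8"
          unfolding w_def u_def[symmetric] by (simp add: right_diff_distrib[symmetric] abs_mult)
        then have "\<bar>of_int i - w A\<bar> \<le> 8" using True by simp
        then have ik: "0 \<le> i - \<lfloor>w A\<rfloor> + 8" "i - \<lfloor>w A\<rfloor> + 8 < 18" by linarith+
        define k where "k = nat (i - \<lfloor>w A\<rfloor> + 8)"
        have k: "k < 18" "\<lfloor>w A\<rfloor> + int k - 8 = i" using ik by (auto simp: k_def)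
        have "z \<in> V (A, k)" using A(2) x F[OF x(1)] True k(2) unfolding V_def by auto
        then show ?thesis unfolding Fam_def using A(1) k(1) by blast
      next
        case False
        then have i': "of_int i < 2 ^ q * C x" using i by simp
        have "0 \<le> i" using cantor_bounds(1)[of x] by (simp add: i_def)
        have "2 ^ q * C x \<le> 2 ^ q" using cantor_bounds(2)[of x] by simp
        then have "(of_int i :: real) < 2 ^ q" using i' by linarith
        then have "i < 2 ^ q" using of_int_less_iff[of i "2 ^ q", where 'a = real] by simp
        define j where "j = nat i"
        have j: "j < 2 ^ q" "real j = of_int i" using \<open>0 \<le> i\<close> \<open>i < 2 ^ q\<close>
          by (auto simp: j_def nat_less_iff)
        define m where "m = nat \<lfloor>(F x + M) / (\<delta> / 2)\<rfloor>"
        have FM: "0 \<le> F x + M" "F x + M \<le> 2 * M" using M[OF x(1)] by auto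
        then have "0 \<le> (F x + M) / (\<delta> / 2)" using d by simp
        then have m: "real m \<le> (F x + M) / (\<delta> / 2)" "(F x + M) / (\<delta> / 2) < real m + 1"
          unfolding m_def by linarith+
        have "(F x + M) / (\<delta> / 2) \<le> 4 * M / \<delta>" using FM d by (simp add: divide_right_mono)
        then have "m < L" using nat_mono[OF floor_mono] unfolding L_def m_def by fastforce
        have "z \<in> S (j, m)" using x i' i j m d unfolding S_def
          by (simp add: pos_le_divide_eq pos_divide_less_eq)
        then show ?thesis unfolding Fam_def using j(1) \<open>m < L\<close> by blast
      qed
    qed
    fix A assume "A \<in> Fam"
    then consider (V) B k where "B \<in> F0" "A = V (B, k)" | (S) j m where "A = S (j, m)"
      unfolding Fam_def by auto
    then have "bounded A \<and> diameter A \<le> \<delta>"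
    proof cases
      case V
      show ?thesis
      proof (rule bounded_diameter_leI)
        fix z z' assume zz: "z \<in> A" "z' \<in> A"
        obtain x y where z: "z = (x, y + h (C x))" "(x, y) \<in> B" "2 ^ q * C x = of_int (\<lfloor>w B\<rfloor> + int k - 8)"
          using zz(1) V(2) unfolding V_def by auto
        obtain x' y' where z': "z' = (x', y' + h (C x'))" "(x', y') \<in> B" "2 ^ q * C x' = of_int (\<lfloor>w B\<rfloor> + int k - 8)"
          using zz(2) V(2) unfolding V_def by auto
        \<comment> \<open>On a level set of \<open>C\<close> the summand \<open>h (C x)\<close> is
          constant, so distances are those within the original piece, whatever \<open>h\<close>
          is.\<close>
        have "2 ^ q * C x = 2 ^ q * C x'" using z(3) z'(3) by simp
        then have "C x = C x'" by simp
        then have "dist z z' = dist (x, y) (x', y')" using z(1) z'(1) by (simp add: dist_Pair_Pair dist_real_def)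
        also have "\<dots> \<le> \<delta>" using diameter_bounded_bound[of B "(x,y)" "(x',y')"] F0(4)[OF V(1)] z(2) z'(2) by linarith
        finally show "dist z z' \<le> \<delta>" .
      qed (use d in simp)
    next
      case S
      show ?thesis
      proof (rule bounded_diameter_leI)
        fix z z' assume zz: "z \<in> A" "z' \<in> A"
        obtain x y where z: "z = (x, y)" by force
        obtain x' y' where z': "z' = (x', y')" by force
        have "\<bar>x - x'\<bar> \<le> l ^ q" using zz S unfolding z z' S_def
          by (intro cantor_inverse_dist[of "int j"]) auto
        moreover have "\<bar>y - y'\<bar> \<le> \<delta> / 2"
        proof -
          have "real m * (\<delta> / 2) \<le> y + M" "y + M \<le> real m * (\<delta> / 2) + \<delta> / 2"
            "real m * (\<delta> / 2) \<le> y' + M" "y' + M \<le> real m * (\<delta> / 2) + \<delta> / 2"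
            using zz S unfolding z z' S_def by (auto simp: distrib_right)
          then show ?thesis by linarith
        qed
        moreover have "dist z z' \<le> \<bar>x - x'\<bar> + \<bar>y - y'\<bar>"
          unfolding z z' dist_Pair_Pair dist_real_def power2_abs by (rule sqrt_sum_squares_le_sum_abs)
        ultimately show "dist z z' \<le> \<delta>" using p(1) unfolding q_def by linarith
      qed (use d in simp)
    qed
    then show "bounded A" "diameter A \<le> \<delta>" by auto
  qed
  moreover have "real (18 * n + 2 ^ q * L) \<le> 18 * real n + (16 * M + 8) * \<delta> powr - s"
  proof -
    have P: "2 ^ q \<le> 4 * \<delta> powr - (s - 1)"
    proof -
      have "(\<delta> / 2) powr (s - 1) \<le> (1/2) ^ p" using p(2) d by (intro half_power_ge) auto
      moreover have "(\<delta> / 2) powr (s - 1) = \<delta> powr (s - 1) * (1/2) powr (s - 1)"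
        using d powr_mult[of \<delta> "1/2" "s - 1"] by simp
      moreover have "(1/2) powr 1 \<le> (1/2::real) powr (s - 1)" using s2 by (intro powr_mono') auto
      then have "\<delta> powr (s - 1) * (1/2) \<le> \<delta> powr (s - 1) * (1/2) powr (s - 1)" by (intro mult_left_mono) auto
      ultimately have "\<delta> powr (s - 1) * (1/2) \<le> 1 / 2 ^ p" by (simp add: power_one_over)
      then have "2 ^ q * \<delta> powr (s - 1) \<le> 4" by (simp add: q_def field_simps)
      moreover have "0 < \<delta> powr (s - 1)" using d by simp
      ultimately show ?thesis unfolding powr_minus by (simp add: field_simps)
    qed
    have "real L \<le> 4 * M / \<delta> + 1" unfolding L_def using M0 d by simp
    also have "\<dots> \<le> (4 * M + 2) / \<delta>" using d M0 by (simp add: field_simps)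
    finally have "2 ^ q * real L \<le> (4 * \<delta> powr - (s - 1)) * ((4 * M + 2) / \<delta>)"
      using P by (intro mult_mono) auto
    also have "\<dots> = (16 * M + 8) * (\<delta> powr - (s - 1) * \<delta> powr - 1)"
      using d by (simp add: powr_minus_divide[of \<delta> 1] algebra_simps add_divide_distrib)
    also have "\<delta> powr - (s - 1) * \<delta> powr - 1 = \<delta> powr - s" by (simp only: powr_add[symmetric]) simp
    finally show ?thesis by simp
  qed
  ultimately show ?thesis using that by blast
qed

lemma box_le_add_comp_cantor:
  assumes "\<And>x. x \<in> {0..1} \<Longrightarrow> F x = f x + h (C x)" "F \<in> C01" "box_le s (graph_on f {0..1})"
  shows "box_le s (graph_on F {0..1})"
  unfolding box_le_def
proof (intro allI impI)
  fix t assume "s < t"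
  define t' where "t' = (s + t) / 2"
  have t': "s < t'" "t' < t" using \<open>s < t\<close> by (auto simp: t'_def)
  have "compact (F ` {0..1})" using assms(2) by (intro compact_continuous_image) (auto simp: C01_def)
  then obtain M where M: "\<And>x. x \<in> {0..1} \<Longrightarrow> \<bar>F x\<bar> \<le> M"
    using compact_imp_bounded[THEN bounded_iff[THEN iffD1]] by (metis imageI real_norm_def)
  have M0: "0 \<le> M" using M[of 0] by fastforce
  have "\<forall>\<^sub>F \<delta> in at_right 0. \<exists>n. coverable \<delta> n (graph_on f {0..1}) \<and> real n \<le> \<delta> powr - t'"
    using assms(3) t' by (simp add: box_le_def)
  moreover have "\<forall>\<^sub>F \<delta> in at_right 0. \<delta> powr (t - t') \<le> 1 / (16 * M + 26)"
    using t' M0 by (intro eventually_le_powr) auto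
  moreover have "\<forall>\<^sub>F \<delta> in at_right (0::real). 0 < \<delta> \<and> \<delta> < 1" by (rule eventually_small) auto
  ultimately show "\<forall>\<^sub>F \<delta> in at_right 0. \<exists>n. coverable \<delta> n (graph_on F {0..1}) \<and> real n \<le> \<delta> powr - t"
  proof eventually_elim
    case (elim \<delta>)
    then have d: "0 < \<delta>" "\<delta> < 1" by auto
    obtain n where n: "coverable \<delta> n (graph_on f {0..1})" "real n \<le> \<delta> powr - t'" using elim by blast
    obtain n' where n': "coverable \<delta> n' (graph_on F {0..1})"
      "real n' \<le> 18 * real n + (16 * M + 8) * \<delta> powr - s"
      using coverable_add_comp_cantor[OF assms(1) M n(1) d] by blast
    have "\<delta> powr - s \<le> \<delta> powr - t'" using t' d by (intro powr_mono') auto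
    then have "(16 * M + 8) * \<delta> powr - s \<le> (16 * M + 8) * \<delta> powr - t'" using M0 by (intro mult_left_mono) auto
    then have "real n' \<le> (16 * M + 26) * \<delta> powr - t'" using n' n by (simp add: distrib_right)
    also have "\<dots> = ((16 * M + 26) * \<delta> powr (t - t')) * \<delta> powr - t"
      by (simp add: mult.assoc powr_add[symmetric])
    also have "\<dots> \<le> 1 * \<delta> powr - t"
      using elim M0 by (intro mult_right_mono) (auto simp: field_simps)
    finally show ?case using n' by auto
  qed
qed

end

text \<open>The zero function lies in every span but not in \<open>HB s\<close>; this bound both
  excludes it from \<open>HB s\<close> and admits it as \<open>f\<close> when a new direction is
  added.\<close>

lemma box_le_zero_graph: "box_le 1 (graph_on 0 {0..1})"
  unfolding box_le_def
proof (intro allI impI)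
  fix t :: real assume t: "1 < t"
  have "\<forall>\<^sub>F \<delta> in at_right 0. \<delta> powr (t - 1) \<le> 1 / 2"
    using t by (intro eventually_le_powr) auto
  moreover have "\<forall>\<^sub>F \<delta> in at_right (0::real). 0 < \<delta> \<and> \<delta> < 1" by (rule eventually_small) auto
  ultimately show "\<forall>\<^sub>F \<delta> in at_right 0. \<exists>n. coverable \<delta> n (graph_on (0::real \<Rightarrow> real) {0..1}) \<and> real n \<le> \<delta> powr - t"
  proof eventually_elim
    case (elim \<delta>)
    then have d: "0 < \<delta>" "\<delta> < 1" by auto
    define n where "n = nat \<lfloor>1 / \<delta>\<rfloor> + 1"
    define U where "U m = {real m * \<delta> .. (real m + 1) * \<delta>} \<times> {0::real}" for m
    have "coverable \<delta> n (graph_on (0::real \<Rightarrow> real) {0..1})"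
      unfolding coverable_def
    proof (intro exI[of _ "U ` {..<n}"] conjI ballI)
      show "card (U ` {..<n}) \<le> n" using card_image_le[of "{..<n}" U] by simp
      show "graph_on (0::real \<Rightarrow> real) {0..1} \<subseteq> \<Union>(U ` {..<n})"
      proof
        fix z assume "z \<in> graph_on (0::real \<Rightarrow> real) {0..1}"
        then obtain x :: real where x: "0 \<le> x" "x \<le> 1" "z = (x, 0)" by (auto simp: graph_on_def)
        define m where "m = nat \<lfloor>x / \<delta>\<rfloor>"
        have "0 \<le> x / \<delta>" using x d by simp
        then have m: "real m \<le> x / \<delta>" "x / \<delta> < real m + 1" unfolding m_def by linarith+
        have "\<lfloor>x / \<delta>\<rfloor> \<le> \<lfloor>1 / \<delta>\<rfloor>" using x d by (intro floor_mono divide_right_mono) auto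
        then have "m < n" unfolding m_def n_def by linarith
        moreover have "z \<in> U m" using m x d by (auto simp: U_def pos_le_divide_eq pos_divide_less_eq)
        ultimately show "z \<in> \<Union>(U ` {..<n})" by blast
      qed
      fix A assume "A \<in> U ` {..<n}"
      then obtain m where A: "A = U m" by blast
      have "bounded A \<and> diameter A \<le> \<delta>"
      proof (rule bounded_diameter_leI)
        fix z z' assume "z \<in> A" "z' \<in> A"
        then obtain x x' where "z = (x, 0)" "z' = (x', 0)"
          "x \<in> {real m * \<delta> .. real m * \<delta> + \<delta>}" "x' \<in> {real m * \<delta> .. real m * \<delta> + \<delta>}"
          unfolding A U_def by (auto simp: distrib_right)
        then show "dist z z' \<le> \<delta>" by (auto simp: dist_Pair_Pair dist_real_def)
      qed (use d in simp)
      then show "bounded A" "diameter A \<le> \<delta>" by auto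
    qed simp
    moreover have "real n \<le> \<delta> powr - t"
    proof -
      have "real n \<le> 1 / \<delta> + 1" unfolding n_def using d by simp
      also have "\<dots> \<le> 2 * \<delta> powr - 1" using d by (simp add: powr_minus_divide field_simps)
      also have "\<dots> = (2 * \<delta> powr (t - 1)) * \<delta> powr - t" by (simp add: mult.assoc powr_add[symmetric])
      also have "\<dots> \<le> 1 * \<delta> powr - t" using elim by (intro mult_right_mono) auto
      finally show ?thesis by simp
    qed
    ultimately show ?case by blast
  qed
qed

lemma zero_notin_HB: "1 < s \<Longrightarrow> 0 \<notin> HB s"
  using upper_box_dim_le[OF box_le_zero_graph] by (auto simp: HB_def)

section \<open>Frequencies adapted to finitely many functions, and enlargement of subspaces\<close>

lemma subspace_C01: "subspace C01"
  unfolding subspace_def C01_def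
  by (auto simp: plus_fun_def zero_fun_def scaleR_fun_def intro!: continuous_intros)

lemma eventually_oscillation_le:
  assumes "f \<in> C01" "0 < l" "l < 1" "0 < e"
  shows "\<forall>\<^sub>F n in sequentially. \<forall>x\<in>{0..1}. \<forall>y\<in>{0..1}. \<bar>x - y\<bar> \<le> l ^ Suc n \<longrightarrow> \<bar>f x - f y\<bar> \<le> e"
proof -
  have "uniformly_continuous_on {0..1} f"
    using assms(1) by (intro compact_uniformly_continuous) (auto simp: C01_def)
  then obtain d where d: "0 < d" "\<And>x y. x \<in> {0..1} \<Longrightarrow> y \<in> {0..1} \<Longrightarrow> dist x y < d \<Longrightarrow> dist (f x) (f y) < e"
    using assms(4) unfolding uniformly_continuous_on_def by metis
  have "(\<lambda>n. l ^ Suc n) \<longlonglongrightarrow> 0" using assms by (intro LIMSEQ_Suc LIMSEQ_power_zero) auto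
  then have "\<forall>\<^sub>F n in sequentially. l ^ Suc n < d" using d(1) by (rule order_tendstoD)
  then show ?thesis
  proof eventually_elim
    case (elim n)
    then show ?case using d(2) unfolding dist_real_def by (meson less_imp_le order_le_less_trans)
  qed
qed

text \<open>Once \<open>p k\<close> is fixed, each requirement on \<open>p (Suc k)\<close> holds for
  all large values, the oscillation bound because \<open>B\<close> is finite; so the sequence can be
  chosen recursively.\<close>

lemma rapid_sequence_exists:
  assumes "finite B" "B \<subseteq> C01" "0 < l" "l < 1"
  obtains p :: "nat \<Rightarrow> nat" where "\<And>k. 2 * 2 ^ p k \<le> rho (Suc k) * 2 ^ p (Suc k)" "\<And>k. l ^ p k \<le> rho k"
    "\<And>k f x y. f \<in> B \<Longrightarrow> x \<in> {0..1} \<Longrightarrow> y \<in> {0..1} \<Longrightarrow> \<bar>x - y\<bar> \<le> l ^ Suc (p k) \<Longrightarrow> \<bar>f x - f y\<bar> \<le> rho k / real (Suc k)"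
proof -
  define P where "P k n \<longleftrightarrow> l ^ n \<le> rho k \<and>
    (\<forall>f\<in>B. \<forall>x\<in>{0..1}. \<forall>y\<in>{0..1}. \<bar>x - y\<bar> \<le> l ^ Suc n \<longrightarrow> \<bar>f x - f y\<bar> \<le> rho k / real (Suc k))" for k n
  have P: "\<forall>\<^sub>F n in sequentially. P k n" for k
  proof -
    have "(\<lambda>n. l ^ n) \<longlonglongrightarrow> 0" using assms by (intro LIMSEQ_power_zero) auto
    then have "\<forall>\<^sub>F n in sequentially. l ^ n < rho k" using rho_pos by (rule order_tendstoD)
    then have "\<forall>\<^sub>F n in sequentially. l ^ n \<le> rho k" by eventually_elim simp
    moreover have "\<forall>\<^sub>F n in sequentially. \<forall>f\<in>B. \<forall>x\<in>{0..1}. \<forall>y\<in>{0..1}.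
       \<bar>x - y\<bar> \<le> l ^ Suc n \<longrightarrow> \<bar>f x - f y\<bar> \<le> rho k / real (Suc k)"
      using assms rho_pos[of k] by (intro eventually_ball_finite ballI eventually_oscillation_le) auto
    ultimately show ?thesis unfolding P_def by (rule eventually_conj)
  qed
  have "\<exists>p. \<forall>k. P k (p k) \<and> 2 * 2 ^ p k \<le> rho (Suc k) * 2 ^ p (Suc k)"
  proof (rule dependent_nat_choice)
    show "\<exists>n. P 0 n" using P[of 0] by (rule eventually_happens'[rotated]) simp
    fix n k assume "P k n"
    obtain N where N: "2 * 2 ^ n / rho (Suc k) < 2 ^ N" using real_arch_pow[of 2] by auto
    have "\<forall>\<^sub>F m in sequentially. 2 * 2 ^ n / rho (Suc k) \<le> 2 ^ m"
    proof (rule eventually_sequentiallyI)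
      fix m assume "N \<le> m"
      then have "(2::real) ^ N \<le> 2 ^ m" by (intro power_increasing) auto
      then show "2 * 2 ^ n / rho (Suc k) \<le> 2 ^ m" using N by linarith
    qed
    with P[of "Suc k"] have "\<forall>\<^sub>F m in sequentially. P (Suc k) m \<and> 2 * 2 ^ n \<le> rho (Suc k) * 2 ^ m"
      by eventually_elim (use rho_pos[of "Suc k"] in \<open>simp add: divide_le_eq mult.commute\<close>)
    then show "\<exists>m. P (Suc k) m \<and> 2 * 2 ^ n \<le> rho (Suc k) * 2 ^ m"
      by (rule eventually_happens'[rotated]) simp
  qed
  then obtain p where p: "\<And>k. P k (p k)" "\<And>k. 2 * 2 ^ p k \<le> rho (Suc k) * 2 ^ p (Suc k)" by blast
  show ?thesis using p that[of p] unfolding P_def by blast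
qed

text \<open>The divisor \<open>Suc k\<close> eventually exceeds the constant \<open>A\<close> that a
  fixed linear combination costs. Thus one sequence serves the whole span, with only the threshold
  \<open>K\<close> depending on \<open>f\<close>.\<close>

lemma span_oscillation_le:
  fixes B :: "(real \<Rightarrow> real) set"
  assumes osc: "\<And>k f x y. f \<in> B \<Longrightarrow> x \<in> {0..1} \<Longrightarrow> y \<in> {0..1} \<Longrightarrow> \<bar>x - y\<bar> \<le> d k \<Longrightarrow> \<bar>f x - f y\<bar> \<le> rho k / real (Suc k)"
    and f: "f \<in> span B"
  shows "\<exists>K. \<forall>k\<ge>K. \<forall>x\<in>{0..1}. \<forall>y\<in>{0..1}. \<bar>x - y\<bar> \<le> d k \<longrightarrow> \<bar>f x - f y\<bar> \<le> rho k"
proof -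
  define Q where "Q = {f :: real \<Rightarrow> real. \<exists>A\<ge>0. \<forall>k. \<forall>x\<in>{0..1}. \<forall>y\<in>{0..1}. \<bar>x - y\<bar> \<le> d k \<longrightarrow> \<bar>f x - f y\<bar> \<le> A * (rho k / real (Suc k))}"
  have "subspace Q"
  proof (rule subspaceI)
    show "0 \<in> Q" unfolding Q_def by (auto intro!: exI[of _ 0])
  next
    fix f g assume "f \<in> Q" "g \<in> Q"
    then obtain A A' where A: "0 \<le> A" "\<And>k x y. x \<in> {0..1} \<Longrightarrow> y \<in> {0..1} \<Longrightarrow> \<bar>x - y\<bar> \<le> d k \<Longrightarrow> \<bar>f x - f y\<bar> \<le> A * (rho k / real (Suc k))"
      and A': "0 \<le> A'" "\<And>k x y. x \<in> {0..1} \<Longrightarrow> y \<in> {0..1} \<Longrightarrow> \<bar>x - y\<bar> \<le> d k \<Longrightarrow> \<bar>g x - g y\<bar> \<le> A' * (rho k / real (Suc k))"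
      unfolding Q_def by blast
    have "\<bar>(f + g) x - (f + g) y\<bar> \<le> (A + A') * (rho k / real (Suc k))"
      if "x \<in> {0..1}" "y \<in> {0..1}" "\<bar>x - y\<bar> \<le> d k" for k x y
      using A(2)[OF that] A'(2)[OF that] unfolding plus_fun_apply distrib_right by linarith
    then show "f + g \<in> Q" unfolding Q_def using A(1) A'(1) by (intro CollectI exI[of _ "A + A'"]) (simp del: plus_fun_apply)
  next
    fix f c assume "f \<in> Q"
    then obtain A where A: "0 \<le> A" "\<And>k x y. x \<in> {0..1} \<Longrightarrow> y \<in> {0..1} \<Longrightarrow> \<bar>x - y\<bar> \<le> d k \<Longrightarrow> \<bar>f x - f y\<bar> \<le> A * (rho k / real (Suc k))"
      unfolding Q_def by blast
    have "\<bar>(c *\<^sub>R f) x - (c *\<^sub>R f) y\<bar> \<le> (\<bar>c\<bar> * A) * (rho k / real (Suc k))"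
      if "x \<in> {0..1}" "y \<in> {0..1}" "\<bar>x - y\<bar> \<le> d k" for k x y
      using mult_left_mono[OF A(2)[OF that], of "\<bar>c\<bar>"]
      by (simp add: scaleR_fun_def right_diff_distrib[symmetric] abs_mult)
    then show "c *\<^sub>R f \<in> Q" unfolding Q_def using A(1) by (intro CollectI exI[of _ "\<bar>c\<bar> * A"]) simp
  qed
  moreover have "B \<subseteq> Q" unfolding Q_def using osc by (auto intro!: exI[of _ 1])
  ultimately have "f \<in> Q" using f span_minimal by blast
  then obtain A where A: "0 \<le> A" "\<And>k x y. x \<in> {0..1} \<Longrightarrow> y \<in> {0..1} \<Longrightarrow> \<bar>x - y\<bar> \<le> d k \<Longrightarrow> \<bar>f x - f y\<bar> \<le> A * (rho k / real (Suc k))"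
    unfolding Q_def by blast
  obtain K :: nat where K: "A \<le> real K" using real_arch_simple by blast
  have "\<bar>f x - f y\<bar> \<le> rho k" if "K \<le> k" "x \<in> {0..1}" "y \<in> {0..1}" "\<bar>x - y\<bar> \<le> d k" for k x y
  proof -
    have "A \<le> real (Suc k)" using K that(1) by simp
    then have "A * (rho k / real (Suc k)) \<le> real (Suc k) * (rho k / real (Suc k))"
      using rho_pos[of k] by (intro mult_right_mono) auto
    then show ?thesis using A(2)[OF that(2-4)] by simp
  qed
  then show ?thesis by blast
qed

lemma generic_direction:
  assumes s: "1 < s" "s \<le> 2" and B: "finite B" "B \<subseteq> C01"
  obtains g where "g \<in> C01"
    "\<And>f c. f \<in> span B \<Longrightarrow> c \<noteq> 0 \<Longrightarrow> box_le s (graph_on f {0..1}) \<Longrightarrow> f + c *\<^sub>R g \<in> HB s"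
proof -
  \<comment> \<open>The solution of \<open>l powr (s - 1) = 1/2\<close>; \<open>s \<le> 2\<close>
    makes it at most \<open>1/2\<close>.\<close>
  define l :: real where "l = (1/2) powr (1 / (s - 1))"
  have l: "0 < l" "l \<le> 1/2"
  proof -
    show "0 < l" by (simp add: l_def)
    have "(1/2) powr (1 / (s - 1)) \<le> (1/2::real) powr 1" using s by (intro powr_mono') auto
    then show "l \<le> 1/2" by (simp add: l_def)
  qed
  have l_powr: "l powr (s - 1) = 1/2" using s by (simp add: l_def powr_powr)
  obtain p where p: "\<And>k. 2 * 2 ^ p k \<le> rho (Suc k) * 2 ^ p (Suc k)" "\<And>k. l ^ p k \<le> rho k"
    "\<And>k f x y. f \<in> B \<Longrightarrow> x \<in> {0..1} \<Longrightarrow> y \<in> {0..1} \<Longrightarrow> \<bar>x - y\<bar> \<le> l ^ Suc (p k) \<Longrightarrow> \<bar>f x - f y\<bar> \<le> rho k / real (Suc k)"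
    using rapid_sequence_exists[OF B, of l] l by auto
  interpret cantor_wave l s p
    by unfold_locales (use l l_powr s p(1,2) in auto)
  define g where "g x = (if x \<in> {0..1} then wave p (C x) else 0)" for x
  have "continuous_on {0..1} (\<lambda>x. wave p (C x))"
    by (rule continuous_on_compose2[OF continuous_wave_tail])
       (auto intro: continuous_on_subset[OF continuous_cantor])
  then have "continuous_on {0..1} g" by (rule continuous_on_eq) (simp add: g_def)
  then have g: "g \<in> C01" by (simp add: C01_def g_def)
  show ?thesis
  proof (rule that[OF g])
    fix f and c :: real assume f: "f \<in> span B" and c: "c \<noteq> 0" and box: "box_le s (graph_on f {0..1})"
    define F where "F = f + c *\<^sub>R g"
    have "f \<in> C01" using f span_minimal[OF B(2) subspace_C01] by blast
    then have F: "F \<in> C01" unfolding F_def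
      using g subspace_C01 by (intro subspace_add subspace_scale) auto
    have F_eq: "F x = f x + c * wave p (C x)" if "x \<in> {0..1}" for x
      using that by (simp add: F_def plus_fun_def scaleR_fun_def g_def)
    \<comment> \<open>The scalar is moved to \<open>f\<close>, writing \<open>F\<close> as
      \<open>c\<close> times the sum of \<open>f / c\<close> and the wave; \<open>f / c\<close>
      stays in the span for which \<open>p\<close> was chosen.\<close>
    have "(1 / c) *\<^sub>R f \<in> span B" using f by (rule span_scale)
    then have "\<exists>K. \<forall>k\<ge>K. \<forall>x\<in>{0..1}. \<forall>y\<in>{0..1}. \<bar>x - y\<bar> \<le> l ^ Suc (p k) \<longrightarrow>
       \<bar>((1 / c) *\<^sub>R f) x - ((1 / c) *\<^sub>R f) y\<bar> \<le> rho k"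
      by (intro span_oscillation_le[of B "\<lambda>k. l ^ Suc (p k)"]) (erule (3) p(3))
    then obtain K where K: "\<And>k x y. K \<le> k \<Longrightarrow> x \<in> {0..1} \<Longrightarrow> y \<in> {0..1} \<Longrightarrow> \<bar>x - y\<bar> \<le> l ^ Suc (p k) \<Longrightarrow>
       \<bar>((1 / c) *\<^sub>R f) x - ((1 / c) *\<^sub>R f) y\<bar> \<le> rho k" by blast
    have "F \<in> HB s"
    proof (rule HB_intro[OF F s(1)])
      show "box_le s (graph_on F {0..1})"
        by (rule box_le_add_comp_cantor[of F f "\<lambda>u. c * wave p u", OF F_eq F box])
      fix t assume t: "1 < t" "t < s"
      show "mass_ge t (graph_on F {0..1})"
      proof (rule mass_ge_graph[where K = K and f = "(1 / c) *\<^sub>R f" and c = c])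
        show "\<bar>((1 / c) *\<^sub>R f) x - ((1 / c) *\<^sub>R f) y\<bar> \<le> rho k"
          if "K \<le> k" "x \<in> {0..1}" "y \<in> {0..1}" "\<bar>x - y\<bar> \<le> l ^ Suc (p k)" for k x y
          using that by (rule K)
        show "F x = c * (((1 / c) *\<^sub>R f) x + wave p (C x))" if "x \<in> {0..1}" for x
          using F_eq[OF that] c by (simp add: scaleR_fun_def distrib_left)
      qed (use t c in auto)
    qed
    then show "f + c *\<^sub>R g \<in> HB s" by (simp add: F_def)
  qed
qed

lemma extend_basis_in_HB:
  assumes s: "1 < s" "s \<le> 2" and B: "finite B" "independent B" "span B \<subseteq> HB s \<union> {0}"
  shows "\<exists>B'. finite B' \<and> independent B' \<and> B \<subseteq> B' \<and> card B' = card B + m \<and> span B' \<subseteq> HB s \<union> {0}"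
proof (induction m)
  case 0
  show ?case by (rule exI[of _ B]) (use B in \<open>simp add: zero_fun_def\<close>)
next
  case (Suc m)
  then obtain D where D: "finite D" "independent D" "B \<subseteq> D" "card D = card B + m" "span D \<subseteq> HB s \<union> {0}"
    by blast
  have "D \<subseteq> C01" using D(5) span_superset[of D] subspace_0[OF subspace_C01] by (auto simp: HB_def)
  then obtain g where g: "g \<in> C01"
    "\<And>f c. f \<in> span D \<Longrightarrow> c \<noteq> 0 \<Longrightarrow> box_le s (graph_on f {0..1}) \<Longrightarrow> f + c *\<^sub>R g \<in> HB s"
    using generic_direction[OF s D(1)] by blast
  have box: "box_le s (graph_on f {0..1})" if "f \<in> span D" for f
    using that D(5) HB_box_le box_le_mono[OF box_le_zero_graph, of s] s(1) by fastforce
  \<comment> \<open>Otherwise \<open>- g\<close> would be an admissible \<open>f\<close>, and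
    \<open>c = 1\<close> would put the zero function into \<open>HB s\<close>.\<close>
  have "g \<notin> span D"
  proof
    assume "g \<in> span D"
    then have "- g \<in> span D" by (rule span_neg)
    from g(2)[OF this, of 1] box[OF this] show False using zero_notin_HB[OF s(1)] by simp
  qed
  then have "independent (insert g D)" "g \<notin> D"
    using D(2) span_superset[of D] by (auto simp: independent_insert)
  moreover have "span (insert g D) \<subseteq> HB s \<union> {0}"
  proof
    fix f assume "f \<in> span (insert g D)"
    then obtain c where c: "f - c *\<^sub>R g \<in> span D" unfolding span_breakdown_eq by blast
    show "f \<in> HB s \<union> {0}"
    proof (cases "c = 0")
      case True
      then show ?thesis using c D(5) by auto
    next
      case False
      then show ?thesis using g(2)[OF c False box[OF c]] by simp
    qed
  qed
  ultimately show ?case using D by (intro exI[of _ "insert g D"]) (auto simp: zero_fun_def)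
qed

theorem theorem4p4:
  fixes s :: real and m n :: nat
  assumes "1 < s" and "s \<le> 2" and "1 \<le> m" and "1 \<le> n"
  shows "lineable_pair (HB s) n (n + m)"
  unfolding lineable_pair_def
proof (intro conjI allI impI)
  obtain D where "finite D" "independent D" "card D = n" "span D \<subseteq> HB s \<union> {0}"
    using extend_basis_in_HB[OF assms(1,2), of "{}" n] by (auto simp: independent_empty)
  then show "lineable (HB s) n" unfolding lineable_def
    by (intro exI[of _ "span D"]) (auto simp: dim_eq_card_independent)
next
  fix W assume W: "subspace W \<and> dim W = n \<and> W \<subseteq> HB s \<union> {0}"
  obtain B where B: "B \<subseteq> W" "independent B" "W \<subseteq> span B" "card B = dim W" by (rule basis_exists)
  \<comment> \<open>Infinite sets have \<open>card\<close> 0, so \<open>1 \<le> n\<close> forces the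
    basis to be finite.\<close>
  have fin: "finite B" using B(4) W assms(4) by (intro card_ge_0_finite) auto
  have "span B = W" using B W by (intro span_subspace) auto
  then obtain D where "finite D" "independent D" "B \<subseteq> D" "card D = n + m" "span D \<subseteq> HB s \<union> {0}"
    using extend_basis_in_HB[OF assms(1,2) fin B(2), of m] W B(4) by auto
  then show "\<exists>W'. subspace W' \<and> dim W' = n + m \<and> W \<subseteq> W' \<and> W' \<subseteq> HB s \<union> {0}"
    using \<open>span B = W\<close> span_mono[of B D]
    by (intro exI[of _ "span D"]) (auto simp: dim_eq_card_independent)
qed

end
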